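(* Let $q$ be a prime power, $\mathbb{F}$ an extension field of $\mathbb{F}_q$ (possibly infinite), $1\le k\le n$, and $\ell\ge1$. An $[n,k]_{\mathbb{F}}$ linear code $C$ is $\mathrm{GKP}(\ell)$ if and only if it is $\mathrm{MRD}(\ell)$.
   Context: An $[n,k]_{\mathbb{F}}$ code is a $k$-dimensional $\mathbb{F}$-subspace $C\subseteq\mathbb{F}^n$; $G\in\mathbb{F}^{k\times n}$ is a generator matrix if $C=\{G^T\bm{u}:\bm{u}\in\mathbb{F}^k\}$. For $\bm{v}=(v_1,\dots,v_n)\in\mathbb{F}^n$, $\mathrm{rank}_{\mathbb{F}_q}(\bm{v})=\dim_{\mathbb{F}_q}\mathrm{span}_{\mathbb{F}_q}\{v_1,\dots,v_n\}$; $C$ is MRD if every nonzero codeword has $\mathrm{rank}_{\mathbb{F}_q}\ge n-k+1$. For $A\in\mathbb{F}_q^{n\times d}$, $\langle A\rangle$ is its column span over $\mathbb{F}_q$; for an $\mathbb{F}_q$-subspace $V\subseteq\mathbb{F}_q^n$, $G_V\subseteq\mathbb{F}^k$ denotes the $\mathbb{F}$-column span of $GA$ for any $A$ with $\langle A\rangle=V$. A kernel pattern is a tuple $\mathcal{V}=(V_1,\dots,V_k)$ of $\mathbb{F}_q$-subspaces of $\mathbb{F}_q^n$; it is a generic kernel pattern (GKP) if $\dim(\bigcap_{i\in\Omega}V_i)\le k-|\Omega|$ for all nonempty $\Omega\subseteq[k]$; it has order $\ell$ if exactly $\ell$ distinct nonzero subspaces occur among $V_1,\dots,V_k$. $C$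 (with generator matrix $G$) attains $\mathcal{V}$ if, for full-rank $A_i\in\mathbb{F}_q^{n\times\dim V_i}$ with $\langle A_i\rangle=V_i$, there is an invertible $M\in\mathbb{F}^{k\times k}$ with rows $\bm{m}_i$ such that $\bm{m}_iGA_i=0$ for all $i\in[k]$. $C$ is $\mathrm{GKP}(\ell)$ if it is MRD and attains every GKP of order at most $\ell$. $C$ is $\mathrm{MRD}(\ell)$ if for all $\mathbb{F}_q$-subspaces $V_1,\dots,V_\ell\subseteq\mathbb{F}_q^n$ of dimension at most $k$, $\dim_{\mathbb{F}}(\bigcap_{i=1}^\ell G_{V_i})=\dim_{\mathbb{K}}(\bigcap_{i=1}^\ell W_{V_i})$, where $W=(Z_{i,j})_{i\in[k],j\in[n]}$ is a matrix of independent variables over $\mathbb{K}=\mathbb{F}_q(Z_{1,1},\dots,Z_{k,n})$. *)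

theory Defs
  imports Complex_Main "HOL-Library.Poly_Mapping" "HOL-Library.Product_Lexorder" "HOL-Library.Function_Algebras"
    "HOL-Computational_Algebra.Fraction_Field"
begin

text \<open>Vectors over a field are functions nat => field, used with explicit index bounds.
  The base field F_q is a finite field type 'q; the field F is a field type 'f,
  viewed as an extension of F_q through a field homomorphism emb.\<close>

definition vsc :: "'a::field \<Rightarrow> (nat \<Rightarrow> 'a) \<Rightarrow> (nat \<Rightarrow> 'a)" where
  "vsc c f = (\<lambda>i. c * f i)"

definition rank_Fq :: "('q::field \<Rightarrow> 'f::field) \<Rightarrow> nat \<Rightarrow> (nat \<Rightarrow> 'f) \<Rightarrow> nat" where
  "rank_Fq emb n v = vector_space.dim (\<lambda>c x. emb c * x) (v ` {..<n})"

definition codeword :: "(nat \<Rightarrow> nat \<Rightarrow> 'f::field) \<Rightarrow> nat \<Rightarrow> nat \<Rightarrow> (nat \<Rightarrow> 'f) \<Rightarrow> (nat \<Rightarrow> 'f)" where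
  "codeword G k n u = (\<lambda>j. if j < n then (\<Sum>i<k. u i * G i j) else 0)"

definition is_MRD :: "('q::field \<Rightarrow> 'f::field) \<Rightarrow> (nat \<Rightarrow> nat \<Rightarrow> 'f) \<Rightarrow> nat \<Rightarrow> nat \<Rightarrow> bool" where
  "is_MRD emb G k n \<longleftrightarrow>
     (\<forall>u. codeword G k n u \<noteq> (\<lambda>_. 0) \<longrightarrow> rank_Fq emb n (codeword G k n u) \<ge> n - k + 1)"

definition Fq_subspace :: "nat \<Rightarrow> (nat \<Rightarrow> 'q::field) set \<Rightarrow> bool" where
  "Fq_subspace n V \<longleftrightarrow> module.subspace vsc V \<and> (\<forall>v\<in>V. \<forall>j. n \<le> j \<longrightarrow> v j = 0)"

definition is_GKP :: "nat \<Rightarrow> nat \<Rightarrow> (nat \<Rightarrow> (nat \<Rightarrow> 'q::field) set) \<Rightarrow> bool" where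
  "is_GKP k n V \<longleftrightarrow> (\<forall>i<k. Fq_subspace n (V i)) \<and>
     (\<forall>\<Omega>. \<Omega> \<noteq> {} \<and> \<Omega> \<subseteq> {..<k} \<longrightarrow> vector_space.dim vsc (\<Inter>i\<in>\<Omega>. V i) \<le> k - card \<Omega>)"

definition kp_order :: "nat \<Rightarrow> (nat \<Rightarrow> (nat \<Rightarrow> 'q::field) set) \<Rightarrow> nat" where
  "kp_order k V = card ((V ` {..<k}) - {{\<lambda>_. 0}})"

definition attains :: "('q::field \<Rightarrow> 'f::field) \<Rightarrow> (nat \<Rightarrow> nat \<Rightarrow> 'f) \<Rightarrow> nat \<Rightarrow> nat
    \<Rightarrow> (nat \<Rightarrow> (nat \<Rightarrow> 'q) set) \<Rightarrow> bool" where
  "attains emb G k n V \<longleftrightarrow>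
     (\<exists>M N :: nat \<Rightarrow> nat \<Rightarrow> 'f.
        (\<forall>i<k. \<forall>j<k. (\<Sum>r<k. M i r * N r j) = (if i = j then 1 else 0)) \<and>
        (\<forall>i<k. \<forall>j<k. (\<Sum>r<k. N i r * M r j) = (if i = j then 1 else 0)) \<and>
        (\<forall>i<k. \<forall>v\<in>V i. (\<Sum>j<n. (\<Sum>r<k. M i r * G r j) * emb (v j)) = 0))"

definition is_GKP_code :: "('q::field \<Rightarrow> 'f::field) \<Rightarrow> (nat \<Rightarrow> nat \<Rightarrow> 'f) \<Rightarrow> nat \<Rightarrow> nat \<Rightarrow> nat \<Rightarrow> bool" where
  "is_GKP_code emb G k n l \<longleftrightarrow> is_MRD emb G k n \<and>
     (\<forall>V. is_GKP k n V \<and> kp_order k V \<le> l \<longrightarrow> attains emb G k n V)"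

text \<open>G_V: F-span of the vectors G v (v in V), i.e. the column span of G A with <A> = V\<close>
definition Gspan :: "('q::field \<Rightarrow> 'f::field) \<Rightarrow> (nat \<Rightarrow> nat \<Rightarrow> 'f) \<Rightarrow> nat \<Rightarrow> nat
    \<Rightarrow> (nat \<Rightarrow> 'q) set \<Rightarrow> (nat \<Rightarrow> 'f) set" where
  "Gspan emb G k n V = module.span vsc
     ((\<lambda>v. \<lambda>i. if i < k then (\<Sum>j<n. G i j * emb (v j)) else 0) ` V)"

text \<open>The rational function field K = F_q(Z_(i,j)) as fraction field of multivariate polynomials\<close>
type_synonym 'q ratfun = "(((nat \<times> nat) \<Rightarrow>\<^sub>0 nat) \<Rightarrow>\<^sub>0 'q) fract"

definition constK :: "'q::field \<Rightarrow> 'q ratfun" where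
  "constK c = Fract (Poly_Mapping.single 0 c) 1"

definition Zmat :: "nat \<Rightarrow> nat \<Rightarrow> 'q::field ratfun" where
  "Zmat i j = Fract (Poly_Mapping.single (Poly_Mapping.single (i, j) 1) 1) 1"

definition is_MRD_l :: "('q::field \<Rightarrow> 'f::field) \<Rightarrow> (nat \<Rightarrow> nat \<Rightarrow> 'f) \<Rightarrow> nat \<Rightarrow> nat \<Rightarrow> nat \<Rightarrow> bool" where
  "is_MRD_l emb G k n l \<longleftrightarrow>
     (\<forall>V :: nat \<Rightarrow> (nat \<Rightarrow> 'q) set.
        (\<forall>i<l. Fq_subspace n (V i) \<and> vector_space.dim vsc (V i) \<le> k) \<longrightarrow>
        vector_space.dim vsc (\<Inter>i<l. Gspan emb G k n (V i)) =
        vector_space.dim vsc (\<Inter>i<l. Gspan constK (Zmat :: nat \<Rightarrow> nat \<Rightarrow> 'q ratfun) k n (V i)))"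

end

theory Submission
  imports Defs "HOL-Computational_Algebra.Polynomial"
begin

text \<open>By Rado's theorem on independent transversals, applied to the annihilators \<open>(G\<^bsub>V i\<^esub>)\<^sup>\<bottom>\<close>, a code
  attains \<open>V\<close> as soon as \<open>dim (\<Inter>\<^bsub>i\<in>\<Omega>\<^esub> G\<^bsub>V i\<^esub>) \<le> k - |\<Omega>|\<close> for all nonempty \<open>\<Omega>\<close>; for an MRD code, which has
  \<open>dim G\<^bsub>V\<^esub> = dim V\<close> whenever \<open>dim V \<le> k\<close>, attaining \<open>V\<close> forces \<open>V\<close> to be a GKP.

  The generic matrix \<open>W\<close> attains every GKP: a matrix \<open>U\<close> whose \<open>i\<close>-th row is a generic vector orthogonal
  to \<open>V i\<close> attains \<open>V\<close> by the identity matrix. By Rado's theorem over the base field, \<open>U\<close> is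
  still injective on all subspaces of dimension at most \<open>k\<close>, and both properties pass from \<open>U\<close> to \<open>W\<close>
  since they amount to linear systems having a trivial kernel.

  If \<open>G\<close> is MRD, then the dimension of \<open>\<Inter> G\<^bsub>V j\<^esub>\<close> is determined by the order-\<open>l\<close> patterns that \<open>G\<close>
  attains. Both \<open>G\<close>, when it is GKP(l), and \<open>W\<close> attain all GKPs of order at most \<open>l\<close> and nothing else,
  so the dimensions agree. Conversely, MRD(l) transfers the dimension bounds
  from \<open>W\<close> to \<open>G\<close>.\<close>

section \<open>Independent transversals\<close>

context vector_space
begin

lemma finite_basis_exists:
  assumes "V \<subseteq> span W" "finite W"
  obtains B where "finite B" "B \<subseteq> V" "independent B" "V \<subseteq> span B" "card B = dim V"
proof -
  obtain B where B: "B \<subseteq> V" "independent B" "V \<subseteq> span B" "card B = dim V"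
    using basis_exists by blast
  moreover have "finite B"
    using independent_span_bound[OF assms(2) B(2)] B(1) assms(1) by blast
  ultimately show ?thesis using that by blast
qed

lemma dim_mono_finite:
  assumes "V \<subseteq> span W" "finite W"
  shows "dim V \<le> dim W"
proof -
  obtain B where B: "finite B" "B \<subseteq> W" "W \<subseteq> span B" "card B = dim W"
    using finite_basis_exists[OF span_superset assms(2)] by metis
  have "V \<subseteq> span B"
    using assms(1) B(3) span_minimal subspace_span by blast
  then show ?thesis using dim_le_card[of V B] B by simp
qed

text \<open>A basis \<open>I\<close> of the intersection extends to bases \<open>A'\<close> and
  \<open>B'\<close> of both sets; \<open>A' \<union> B'\<close> spans the union, and
  \<open>A' \<inter> B'\<close> contains \<open>I\<close>. Since the sets are intersected rather
  than their spans, only an inequality results. It is the submodularity behind Rado's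
  theorem.\<close>

lemma dim_Un_Int_le:
  assumes "finite A" "finite B"
  shows "dim (A \<union> B) + dim (A \<inter> B) \<le> dim A + dim B"
proof -
  obtain I where I: "I \<subseteq> A \<inter> B" "independent I" "A \<inter> B \<subseteq> span I" "card I = dim (A \<inter> B)"
    using basis_exists by blast
  obtain A' where A': "I \<subseteq> A'" "A' \<subseteq> A" "independent A'" "A \<subseteq> span A'"
    using maximal_independent_subset_extend[of I A] I by auto
  obtain B' where B': "I \<subseteq> B'" "B' \<subseteq> B" "independent B'" "B \<subseteq> span B'"
    using maximal_independent_subset_extend[of I B] I by auto
  have fin: "finite A'" "finite B'"
    using A'(2) B'(2) assms finite_subset by metis+
  have "A \<union> B \<subseteq> span (A' \<union> B')"
    using A'(4) B'(4) span_mono[of A' "A' \<union> B'"] span_mono[of B' "A' \<union> B'"] by blast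
  then have "dim (A \<union> B) \<le> card (A' \<union> B')"
    using fin by (intro dim_le_card) auto
  moreover have "card (A' \<union> B') + card (A' \<inter> B') = card A' + card B'"
    using card_Un_Int[OF fin] by simp
  moreover have "card I \<le> card (A' \<inter> B')"
    using fin A' B' by (intro card_mono) auto
  moreover have "card A' = dim A" "card B' = dim B"
    using basis_card_eq_dim A' B' by auto
  ultimately show ?thesis using I by linarith
qed

lemma independent_if_card_le_dim:
  assumes "finite A" "card A \<le> dim A"
  shows "independent A"
proof -
  obtain B where B: "finite B" "B \<subseteq> A" "independent B" "card B = dim A"
    using finite_basis_exists[OF span_superset assms(1)] by metis
  then have "B = A" using assms card_seteq by metis
  then show ?thesis using B by simp
qed

text \<open>Coefficients are indexed by \<open>B\<close> instead of by its image, so that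
  \<open>g\<close> may take equal values at different points.\<close>

lemma span_image_imp_sum:
  assumes "finite B" "y \<in> span (g ` B)"
  shows "\<exists>x. y = (\<Sum>b\<in>B. scale (x b) (g b))"
  using assms
proof (induction B arbitrary: y rule: finite_induct)
  case (insert a B)
  then obtain c where "y - scale c (g a) \<in> span (g ` B)"
    by (auto simp: span_breakdown_eq)
  then obtain x where x: "y - scale c (g a) = (\<Sum>b\<in>B. scale (x b) (g b))"
    using insert.IH by blast
  have "(\<Sum>b\<in>insert a B. scale ((x(a := c)) b) (g b)) = scale c (g a) + (\<Sum>b\<in>B. scale (x b) (g b))"
    using insert.hyps by (simp, intro sum.cong) auto
  then have "y = (\<Sum>b\<in>insert a B. scale ((x(a := c)) b) (g b))"
    using x by (simp add: algebra_simps)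
  then show ?case by (rule exI[of _ "x(a := c)"])
qed simp

text \<open>Induction on the total size of the sets. If all are singletons, the rank condition for
  \<open>I\<close> itself makes their elements distinct and independent. Otherwise some set has two
  elements, and submodularity shows that one of them can be deleted without violating the rank
  condition.\<close>

theorem rado_independent_transversal:
  assumes "finite I" "\<And>i. i \<in> I \<Longrightarrow> finite (B i)"
    and "\<And>J. J \<subseteq> I \<Longrightarrow> card J \<le> dim (\<Union>i\<in>J. B i)"
  shows "\<exists>m. (\<forall>i\<in>I. m i \<in> B i) \<and> inj_on m I \<and> independent (m ` I)"
  using assms(2,3)
proof (induction "\<Sum>i\<in>I. card (B i)" arbitrary: B rule: less_induct)
  case less
  note fin = less.prems(1) and hall = less.prems(2)
  show ?case
  proof (cases "\<exists>i\<in>I. card (B i) \<ge> 2")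
    case False
    have "\<exists>x. B i = {x}" if "i \<in> I" for i
    proof -
      have "1 \<le> dim (B i)" using hall[of "{i}"] that by simp
      moreover have "dim (B i) \<le> card (B i)" using fin[OF that] by (simp add: dim_le_card')
      ultimately have "card (B i) = 1" using False that by fastforce
      then show ?thesis by (simp add: card_1_singleton_iff)
    qed
    then obtain m where m: "\<And>i. i \<in> I \<Longrightarrow> B i = {m i}" by metis
    have U: "(\<Union>i\<in>I. B i) = m ` I" using m by auto
    have le: "card I \<le> dim (m ` I)" using hall[of I] U by simp
    moreover have "dim (m ` I) \<le> card (m ` I)" using assms(1) by (simp add: dim_le_card')
    moreover have "card (m ` I) \<le> card I" using assms(1) card_image_le by blast
    ultimately have "card (m ` I) = card I" by simp
    then have "inj_on m I" using assms(1) eq_card_imp_inj_on by blast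
    moreover have "independent (m ` I)"
      using le \<open>card (m ` I) = card I\<close> assms(1) by (intro independent_if_card_le_dim) auto
    ultimately show ?thesis using m by blast
  next
    case True
    then obtain i0 where i0: "i0 \<in> I" "card (B i0) \<ge> 2" by blast
    then obtain x y where xy: "x \<in> B i0" "y \<in> B i0" "x \<noteq> y"
      by (metis card_2_iff' obtain_subset_with_card_n subsetD)
    define R where "R z = B(i0 := B i0 - {z})" for z
    have smaller: ?thesis if z: "z \<in> B i0" and h: "\<And>J. J \<subseteq> I \<Longrightarrow> card J \<le> dim (\<Union>i\<in>J. R z i)" for z
    proof -
      have "(\<Sum>i\<in>I. card (R z i)) < (\<Sum>i\<in>I. card (B i))"
      proof (rule sum_strict_mono_ex1[OF assms(1)])
        show "\<forall>i\<in>I. card (R z i) \<le> card (B i)"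
          using fin by (auto simp: R_def intro!: card_mono)
        show "\<exists>i\<in>I. card (R z i) < card (B i)"
          using i0 z fin by (auto simp: R_def intro!: bexI[of _ i0] card_Diff1_less)
      qed
      moreover have "\<And>i. i \<in> I \<Longrightarrow> finite (R z i)" using fin by (auto simp: R_def)
      ultimately obtain m where m: "\<forall>i\<in>I. m i \<in> R z i" "inj_on m I" "independent (m ` I)"
        using less.hyps[of "R z"] h by blast
      moreover have "R z i \<subseteq> B i" for i by (auto simp: R_def)
      ultimately show ?thesis by blast
    qed
    show ?thesis
    proof (rule ccontr)
      assume no: "\<not> ?thesis"
      have "\<exists>J\<subseteq>I. dim (\<Union>i\<in>J. R z i) < card J" if "z \<in> B i0" for z
        using smaller[OF that] no by (meson not_le)
      then obtain J1 J2 where J: "J1 \<subseteq> I" "dim (\<Union>i\<in>J1. R x i) < card J1"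
        "J2 \<subseteq> I" "dim (\<Union>i\<in>J2. R y i) < card J2"
        using xy by meson
      \<comment> \<open>All sets but \<open>B i0\<close> are unchanged, so an index set that
        violates the condition contains \<open>i0\<close>.\<close>
      have mem: "i0 \<in> J" if "J \<subseteq> I" "dim (\<Union>i\<in>J. R z i) < card J" for J z
      proof (rule ccontr)
        assume "i0 \<notin> J"
        then have "(\<Union>i\<in>J. R z i) = (\<Union>i\<in>J. B i)" by (auto simp: R_def)
        then show False using hall[OF that(1)] that(2) by simp
      qed
      have i0J: "i0 \<in> J1" "i0 \<in> J2" using mem J by blast+
      let ?A = "\<Union>i\<in>J1. R x i" and ?B = "\<Union>i\<in>J2. R y i"
      have finJ: "finite J1" "finite J2" using J assms(1) finite_subset by auto
      have finAB: "finite ?A" "finite ?B"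
        using finJ J fin by (auto simp: R_def)
      \<comment> \<open>Since \<open>x \<noteq> y\<close>, the two reduced copies of
        \<open>B i0\<close> together recover it, so the union loses nothing.\<close>
      have "(\<Union>i\<in>J1 \<union> J2. B i) \<subseteq> ?A \<union> ?B"
      proof
        fix v assume "v \<in> (\<Union>i\<in>J1 \<union> J2. B i)"
        then obtain i where i: "i \<in> J1 \<union> J2" "v \<in> B i" by blast
        show "v \<in> ?A \<union> ?B"
        proof (cases "i = i0")
          case True
          then have "v \<in> R x i0 \<or> v \<in> R y i0" using i xy by (auto simp: R_def)
          then show ?thesis using i0J by blast
        next
          case False
          then show ?thesis using i by (auto simp: R_def)
        qed
      qed
      then have "dim (\<Union>i\<in>J1 \<union> J2. B i) \<le> dim (?A \<union> ?B)"
        using finAB span_superset by (intro dim_mono_finite) blast+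
      \<comment> \<open>In the intersection the index \<open>i0\<close> has to be dropped, which
        costs one. The two violations are strict and account for two, contradicting
        submodularity.\<close>
      moreover have "(\<Union>i\<in>J1 \<inter> J2 - {i0}. B i) \<subseteq> ?A \<inter> ?B"
        by (auto simp: R_def)
      then have "dim (\<Union>i\<in>J1 \<inter> J2 - {i0}. B i) \<le> dim (?A \<inter> ?B)"
        using finAB span_superset by (intro dim_mono_finite) blast+
      moreover have "card (J1 \<union> J2) \<le> dim (\<Union>i\<in>J1 \<union> J2. B i)"
        using J by (intro hall) auto
      moreover have "card (J1 \<inter> J2 - {i0}) \<le> dim (\<Union>i\<in>J1 \<inter> J2 - {i0}. B i)"
        using J by (intro hall) auto
      moreover have "card (J1 \<inter> J2) = Suc (card (J1 \<inter> J2 - {i0}))"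
        using i0J finJ by (metis IntI card.remove finite_Int)
      moreover have "card (J1 \<union> J2) + card (J1 \<inter> J2) = card J1 + card J2"
        using card_Un_Int[OF finJ] by simp
      ultimately show False
        using dim_Un_Int_le[OF finAB] J by linarith
    qed
  qed
qed

end

section \<open>Finite vectors and orthogonal complements\<close>

interpretation vs: vector_space "vsc :: 'a::field \<Rightarrow> (nat \<Rightarrow> 'a) \<Rightarrow> nat \<Rightarrow> 'a"
  by unfold_locales (auto simp: vsc_def fun_eq_iff algebra_simps)

lemma vsc_apply [simp]: "vsc c v i = c * v i"
  by (simp add: vsc_def)

lemma sum_fun_apply: "(\<Sum>a\<in>A. f a) i = (\<Sum>a\<in>A. f a i)"
  for f :: "'a \<Rightarrow> 'b \<Rightarrow> 'c::comm_monoid_add"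
  by (induction A rule: infinite_finite_induct) auto

definition fvec :: "nat \<Rightarrow> (nat \<Rightarrow> 'a::field) set" where
  "fvec k = {v. \<forall>j\<ge>k. v j = 0}"

definition unit_vec :: "nat \<Rightarrow> nat \<Rightarrow> 'a::field" where
  "unit_vec i = (\<lambda>j. if j = i then 1 else 0)"

definition dot :: "nat \<Rightarrow> (nat \<Rightarrow> 'a::field) \<Rightarrow> (nat \<Rightarrow> 'a) \<Rightarrow> 'a" where
  "dot k u v = (\<Sum>i<k. u i * v i)"

definition perp :: "nat \<Rightarrow> (nat \<Rightarrow> 'a::field) set \<Rightarrow> (nat \<Rightarrow> 'a) set" where
  "perp k S = {u \<in> fvec k. \<forall>v\<in>S. dot k u v = 0}"

lemma subspace_fvec: "vs.subspace (fvec k)"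
  by (auto simp: vs.subspace_def fvec_def)

lemma unit_vec_fvec: "i < k \<Longrightarrow> unit_vec i \<in> fvec k"
  by (auto simp: fvec_def unit_vec_def)

lemma fvec_eq_sum: "v \<in> fvec k \<Longrightarrow> v = (\<Sum>i<k. vsc (v i) (unit_vec i))"
  by (auto simp: fun_eq_iff sum_fun_apply unit_vec_def fvec_def if_distrib not_less cong: if_cong)

lemma fvec_subset_span: "fvec k \<subseteq> vs.span (unit_vec ` {..<k})"
proof
  fix v :: "nat \<Rightarrow> 'a" assume "v \<in> fvec k"
  then have "v = (\<Sum>i<k. vsc (v i) (unit_vec i))" by (rule fvec_eq_sum)
  moreover have "(\<Sum>i<k. vsc (v i) (unit_vec i)) \<in> vs.span (unit_vec ` {..<k})"
    by (intro vs.span_sum vs.span_scale vs.span_base) auto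
  ultimately show "v \<in> vs.span (unit_vec ` {..<k})" by simp
qed

lemma inj_unit_vec: "inj_on (unit_vec :: nat \<Rightarrow> nat \<Rightarrow> 'a::field) A"
  by (rule inj_onI) (metis unit_vec_def zero_neq_one)

lemma independent_unit_vec: "vs.independent ((unit_vec :: nat \<Rightarrow> nat \<Rightarrow> 'a::field) ` {..<k})"
proof (rule vs.independent_if_scalars_zero)
  fix f :: "(nat \<Rightarrow> 'a) \<Rightarrow> 'a" and x :: "nat \<Rightarrow> 'a"
  assume s: "(\<Sum>x\<in>unit_vec ` {..<k}. vsc (f x) x) = 0" and x: "x \<in> unit_vec ` {..<k}"
  then obtain i where i: "i < k" "x = unit_vec i" by auto
  have "0 = (\<Sum>x\<in>unit_vec ` {..<k}. vsc (f x) x) i" by (simp add: s)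
  also have "\<dots> = (\<Sum>j<k. vsc (f (unit_vec j)) (unit_vec j)) i"
    by (simp add: sum.reindex[OF inj_unit_vec])
  also have "\<dots> = f (unit_vec i)"
    using i by (simp add: sum_fun_apply unit_vec_def if_distrib cong: if_cong)
  finally show "f x = 0" using i by simp
qed auto

lemma dim_fvec: "vs.dim (fvec k :: (nat \<Rightarrow> 'a::field) set) = k"
proof (rule vs.dim_unique)
  show "unit_vec ` {..<k} \<subseteq> (fvec k :: (nat \<Rightarrow> 'a) set)" using unit_vec_fvec by blast
qed (auto simp: card_image inj_unit_vec independent_unit_vec fvec_subset_span[THEN subsetD])

lemma fvec_basis_exists:
  assumes "S \<subseteq> fvec k"
  obtains B where "finite B" "B \<subseteq> S" "vs.independent B" "S \<subseteq> vs.span B" "card B = vs.dim S"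
proof (rule vs.finite_basis_exists)
  show "S \<subseteq> vs.span (unit_vec ` {..<k})" using assms fvec_subset_span by blast
qed (use that in auto)

lemma finite_independent_fvec:
  assumes "vs.independent B" "B \<subseteq> fvec k"
  shows "finite B"
proof -
  have "B \<subseteq> vs.span (unit_vec ` {..<k})" using assms fvec_subset_span by blast
  then show ?thesis using vs.independent_span_bound[of "unit_vec ` {..<k}" B] assms by simp
qed

lemma dim_mono_fvec:
  assumes "S \<subseteq> vs.span T" "T \<subseteq> fvec k"
  shows "vs.dim S \<le> vs.dim T"
proof -
  obtain B where B: "finite B" "B \<subseteq> T" "vs.independent B" "T \<subseteq> vs.span B" "card B = vs.dim T"
    using fvec_basis_exists[OF assms(2)] .
  have "S \<subseteq> vs.span B"
    using assms(1) vs.span_minimal[OF B(4) vs.subspace_span] by blast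
  then show ?thesis using vs.dim_le_card B by metis
qed

lemma dim_subset_fvec: "S \<subseteq> T \<Longrightarrow> T \<subseteq> fvec k \<Longrightarrow> vs.dim S \<le> vs.dim T"
  by (rule dim_mono_fvec[OF order_trans[OF _ vs.span_superset]])

lemma dim_le_fvec: "S \<subseteq> fvec k \<Longrightarrow> vs.dim S \<le> k"
  for S :: "(nat \<Rightarrow> 'a::field) set"
  using dim_subset_fvec[of S "fvec k" k] dim_fvec[where ?'a='a] by simp

lemma subspace_eq_fvec:
  assumes "S \<subseteq> T" "T \<subseteq> fvec k" "vs.subspace S" "vs.dim S = vs.dim T"
  shows "S = T"
proof -
  obtain B where B: "finite B" "B \<subseteq> S" "vs.independent B" "S \<subseteq> vs.span B" "card B = vs.dim S"
    using fvec_basis_exists[of S k] assms by blast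
  obtain C where C: "B \<subseteq> C" "C \<subseteq> T" "vs.independent C" "T \<subseteq> vs.span C"
    using vs.maximal_independent_subset_extend[of B T] B assms by blast
  have "card C = vs.dim T" using C vs.basis_card_eq_dim by blast
  then have "B = C" using B C assms finite_independent_fvec[of C k] card_subset_eq[of C B] by auto
  then have "T \<subseteq> vs.span S" using C B vs.span_mono by blast
  then show ?thesis using assms vs.span_eq_iff by blast
qed

section \<open>The bilinear pairing and its orthogonal complements\<close>

lemma dot_add_right: "dot k u (v + w) = dot k u v + dot k u w"
  by (simp add: dot_def distrib_left sum.distrib)

lemma dot_vsc_right: "dot k u (vsc c v) = c * dot k u v"
  by (simp add: dot_def mult.left_commute sum_distrib_left)

lemma dot_commute: "dot k u v = dot k v u"
  by (simp add: dot_def mult.commute)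

lemma dot_add_left: "dot k (v + w) u = dot k v u + dot k w u"
  by (simp add: dot_commute[of _ _ u] dot_add_right)

lemma dot_vsc_left: "dot k (vsc c v) u = c * dot k v u"
  by (simp add: dot_commute[of _ _ u] dot_vsc_right)

lemma dot_zero_right [simp]: "dot k u 0 = 0"
  by (simp add: dot_def)

lemma dot_zero_left [simp]: "dot k 0 u = 0"
  by (simp add: dot_def)

lemma dot_sum_right: "dot k u (\<Sum>a\<in>A. f a) = (\<Sum>a\<in>A. dot k u (f a))"
  unfolding dot_def sum_fun_apply sum_distrib_left by (rule sum.swap)

lemma dot_sum_left: "dot k (\<Sum>a\<in>A. f a) u = (\<Sum>a\<in>A. dot k (f a) u)"
  by (simp add: dot_commute[of _ _ u] dot_sum_right)

lemma dot_unit_vec_right: "i < k \<Longrightarrow> dot k u (unit_vec i) = u i"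
  by (simp add: dot_def unit_vec_def if_distrib cong: if_cong)

lemma subspace_dot_zero: "vs.subspace {v. dot k u v = 0}"
  by (auto simp: vs.subspace_def dot_add_right dot_vsc_right)

lemma subspace_perp: "vs.subspace (perp k S)"
  by (auto simp: vs.subspace_def perp_def fvec_def dot_add_left dot_vsc_left)

lemma perp_fvec: "perp k S \<subseteq> fvec k"
  by (auto simp: perp_def)

lemma perp_span: "perp k (vs.span S) = perp k S"
proof -
  have "dot k u v = 0" if "\<forall>v\<in>S. dot k u v = 0" "v \<in> vs.span S" for u v :: "nat \<Rightarrow> 'a"
    using vs.span_minimal[of S "{v. dot k u v = 0}"] subspace_dot_zero that by blast
  then show ?thesis using vs.span_superset[of S] by (auto simp: perp_def)
qed

text \<open>Prescribed values on an independent set extend to a linear functional, and a functional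
  on \<open>fvec k\<close> is the pairing with the vector of its values at the unit vectors.\<close>

lemma dot_extend:
  fixes f :: "(nat \<Rightarrow> 'a::field) \<Rightarrow> 'a"
  assumes "vs.independent B" "B \<subseteq> fvec k"
  obtains u where "u \<in> fvec k" "\<And>b. b \<in> B \<Longrightarrow> dot k u b = f b"
proof -
  interpret functional: vector_space_pair vsc "(*) :: 'a \<Rightarrow> 'a \<Rightarrow> 'a"
    by unfold_locales (auto simp: algebra_simps)
  obtain g where g: "Vector_Spaces.linear vsc (*) g" "\<And>b. b \<in> B \<Longrightarrow> g b = f b"
    using functional.linear_independent_extend[OF assms(1), of f] by blast
  interpret g: Vector_Spaces.linear vsc "(*)" g by fact
  define u where "u = (\<lambda>i. if i < k then g (unit_vec i) else 0)"
  have "dot k u b = f b" if "b \<in> B" for b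
  proof -
    have "f b = g (\<Sum>i<k. vsc (b i) (unit_vec i))"
      using fvec_eq_sum[of b k] that assms g by auto
    also have "\<dots> = dot k u b"
      by (simp add: g.sum g.scale dot_def u_def mult.commute)
    finally show ?thesis by simp
  qed
  moreover have "u \<in> fvec k" by (simp add: u_def fvec_def)
  ultimately show ?thesis using that by blast
qed

lemma eq_if_dot_eq:
  assumes "u \<in> fvec k" "v \<in> fvec k" "\<And>w. w \<in> fvec k \<Longrightarrow> dot k w u = dot k w v"
  shows "u = v"
proof
  fix i show "u i = v i"
    using assms(1,2) assms(3)[OF unit_vec_fvec, of i]
    by (cases "i < k") (auto simp: fvec_def dot_commute[of _ "unit_vec i"] dot_unit_vec_right)
qed

lemma eq_if_dot_eq_spanning:
  assumes "u \<in> fvec k" "v \<in> fvec k" "fvec k \<subseteq> vs.span B" "\<And>w. w \<in> B \<Longrightarrow> dot k u w = dot k v w"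
  shows "u = v"
proof (rule eq_if_dot_eq[OF assms(1,2)])
  fix w :: "nat \<Rightarrow> 'a" assume "w \<in> fvec k"
  have "vs.span B \<subseteq> {w. dot k u w = dot k v w}"
    using assms(4) by (intro vs.span_minimal) (auto simp: vs.subspace_def dot_add_right dot_vsc_right)
  then show "dot k w u = dot k w v"
    using \<open>w \<in> fvec k\<close> assms(3) by (auto simp: dot_commute[of k w])
qed

lemma fvec_basis_extend:
  assumes "vs.independent B" "B \<subseteq> fvec k"
  obtains C where "finite C" "C \<subseteq> fvec k" "B \<inter> C = {}" "vs.independent (B \<union> C)" "fvec k \<subseteq> vs.span (B \<union> C)" "card B + card C = k"
proof -
  obtain D where D: "B \<subseteq> D" "D \<subseteq> fvec k" "vs.independent D" "fvec k \<subseteq> vs.span D"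
    using vs.maximal_independent_subset_extend[of B "fvec k"] assms by blast
  have fin: "finite D" using finite_independent_fvec D by blast
  have "card D = k" using D vs.basis_card_eq_dim[of D "fvec k"] dim_fvec[where ?'a='a] by auto
  then have "card B + card (D - B) = k"
    using card_Diff_subset[OF _ D(1)] card_mono[OF fin D(1)] finite_subset[OF D(1) fin] by simp
  moreover have "B \<union> (D - B) = D" using D(1) by blast
  ultimately show ?thesis using D fin that[of "D - B"] by auto
qed

text \<open>The pairing may be isotropic, so \<open>S\<close> and \<open>perp k S\<close> can
  intersect. Therefore a basis \<open>B\<close> of the span of \<open>S\<close> is extended by
  \<open>C\<close> to a basis of \<open>fvec k\<close>; the members of the dual basis that belong to
  \<open>C\<close> form a basis of the complement.\<close>

lemma dim_perp_add:
  fixes S :: "(nat \<Rightarrow> 'a::field) set"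
  assumes "S \<subseteq> fvec k"
  shows "vs.dim (perp k S) + vs.dim S = k"
proof -
  obtain B where B: "finite B" "B \<subseteq> S" "vs.independent B" "S \<subseteq> vs.span B" "card B = vs.dim S"
    using fvec_basis_exists[OF assms] .
  obtain C where C: "finite C" "C \<subseteq> fvec k" "B \<inter> C = {}" "vs.independent (B \<union> C)"
    "fvec k \<subseteq> vs.span (B \<union> C)" "card B + card C = k"
    using fvec_basis_extend[OF B(3) order_trans[OF B(2) assms]] .
  have BC: "B \<union> C \<subseteq> fvec k" using B C assms by blast
  have "\<exists>u\<in>fvec k. \<forall>b\<in>B \<union> C. dot k u b = (if c = b then 1 else 0)" for c
    by (rule dot_extend[OF C(4) BC, where f="\<lambda>b. if c = b then 1 else 0"]) blast
  then obtain u :: "(nat \<Rightarrow> 'a) \<Rightarrow> nat \<Rightarrow> 'a"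
    where u: "\<And>c. u c \<in> fvec k" "\<And>c b. b \<in> B \<union> C \<Longrightarrow> dot k (u c) b = (if c = b then 1 else 0)"
    by metis
  have "vs.span B = vs.span S"
    using B by (meson subset_antisym vs.span_minimal vs.span_mono vs.subspace_span)
  then have perp: "perp k S = perp k B" using perp_span by metis
  have inj: "inj_on u C"
    by (rule inj_onI) (metis UnI2 u(2) zero_neq_one)
  have "vs.dim (perp k S) = card (u ` C)"
  proof (rule vs.dim_unique[OF _ _ _ refl])
    show "u ` C \<subseteq> perp k S" unfolding perp using u C(3) by (auto simp: perp_def)
    show "perp k S \<subseteq> vs.span (u ` C)"
    proof
      fix v assume v: "v \<in> perp k S"
      have "v = (\<Sum>c\<in>C. vsc (dot k v c) (u c))"
      proof (rule eq_if_dot_eq_spanning[OF _ _ C(5)])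
        show "v \<in> fvec k" using v perp_fvec by blast
        show "(\<Sum>c\<in>C. vsc (dot k v c) (u c)) \<in> fvec k"
          using u(1) by (intro vs.subspace_sum vs.subspace_scale subspace_fvec)
        fix w assume w: "w \<in> B \<union> C"
        then have "dot k (\<Sum>c\<in>C. vsc (dot k v c) (u c)) w = (\<Sum>c\<in>C. if c = w then dot k v c else 0)"
          using u(2) by (auto simp: dot_sum_left dot_vsc_left intro!: sum.cong)
        also have "\<dots> = dot k v w"
          using w v[unfolded perp] C(1) by (auto simp: perp_def)
        finally show "dot k v w = dot k (\<Sum>c\<in>C. vsc (dot k v c) (u c)) w" by simp
      qed
      moreover have "(\<Sum>c\<in>C. vsc (dot k v c) (u c)) \<in> vs.span (u ` C)"
        by (intro vs.span_sum vs.span_scale vs.span_base) auto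
      ultimately show "v \<in> vs.span (u ` C)" by simp
    qed
    show "vs.independent (u ` C)"
    proof (rule vs.independent_if_scalars_zero)
      fix f x assume s: "(\<Sum>x\<in>u ` C. vsc (f x) x) = 0" and "x \<in> u ` C"
      then obtain c where c: "c \<in> C" "x = u c" by blast
      have "0 = dot k (\<Sum>x\<in>u ` C. vsc (f x) x) c" by (simp add: s)
      also have "\<dots> = (\<Sum>a\<in>C. if a = c then f (u c) else 0)"
        using c u(2) by (auto simp: sum.reindex[OF inj] dot_sum_left dot_vsc_left intro!: sum.cong)
      finally show "f x = 0" using c C(1) by simp
    qed (use C in auto)
  qed
  then show ?thesis using card_image[OF inj] C(6) B(5) by simp
qed

lemma perp_perp:
  assumes "vs.subspace S" "S \<subseteq> fvec k"
  shows "perp k (perp k S) = S"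
proof -
  have "S \<subseteq> perp k (perp k S)"
    using assms by (auto simp: perp_def dot_commute)
  then show ?thesis
    using subspace_eq_fvec[OF _ perp_fvec assms(1), of k "perp k S"] dim_perp_add[OF assms(2)]
      dim_perp_add[OF perp_fvec, of k S]
    by simp
qed

section \<open>Invertible matrices and transversals of complements\<close>

definition inverse_mats :: "nat \<Rightarrow> (nat \<Rightarrow> nat \<Rightarrow> 'a::field) \<Rightarrow> (nat \<Rightarrow> nat \<Rightarrow> 'a) \<Rightarrow> bool" where
  "inverse_mats k M N \<longleftrightarrow>
     (\<forall>i<k. \<forall>j<k. (\<Sum>r<k. M i r * N r j) = (if i = j then 1 else 0)) \<and>
     (\<forall>i<k. \<forall>j<k. (\<Sum>r<k. N i r * M r j) = (if i = j then 1 else 0))"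

lemma inverse_mats_expand:
  assumes "inverse_mats k M N" "r < k"
  shows "y r = (\<Sum>i<k. N r i * dot k (M i) y)"
proof -
  have "(\<Sum>i<k. N r i * dot k (M i) y) = (\<Sum>j<k. (\<Sum>i<k. N r i * M i j) * y j)"
    unfolding dot_def sum_distrib_left sum_distrib_right mult.assoc by (rule sum.swap)
  also have "\<dots> = (\<Sum>j<k. if r = j then y j else 0)"
    using assms by (intro sum.cong) (auto simp: inverse_mats_def)
  finally show ?thesis using assms by simp
qed

text \<open>Expanding through the inverse, a vector killed by the rows in \<open>T\<close> is a
  combination of the columns of \<open>N\<close> with index outside \<open>T\<close>.\<close>

lemma dim_common_kernel_le:
  fixes M :: "nat \<Rightarrow> nat \<Rightarrow> 'a::field"
  assumes "inverse_mats k M N" "T \<subseteq> {..<k}"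
    and "S \<subseteq> fvec k" "\<And>y i. y \<in> S \<Longrightarrow> i \<in> T \<Longrightarrow> dot k (M i) y = 0"
  shows "vs.dim S \<le> k - card T"
proof -
  define c where "c i = (\<lambda>r. if r < k then N r i else 0)" for i
  have "S \<subseteq> vs.span (c ` ({..<k} - T))"
  proof
    fix y assume y: "y \<in> S"
    have "y = (\<Sum>i\<in>{..<k} - T. vsc (dot k (M i) y) (c i))"
    proof
      fix r
      show "y r = (\<Sum>i\<in>{..<k} - T. vsc (dot k (M i) y) (c i)) r"
      proof (cases "r < k")
        case True
        have "y r = (\<Sum>i<k. N r i * dot k (M i) y)" by (rule inverse_mats_expand[OF assms(1) True])
        also have "\<dots> = (\<Sum>i\<in>{..<k} - T. N r i * dot k (M i) y)"
          using assms(4)[OF y] by (intro sum.mono_neutral_right) auto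
        finally show ?thesis using True by (simp add: sum_fun_apply c_def mult.commute)
      next
        case False
        then show ?thesis using y assms(3) by (auto simp: fvec_def sum_fun_apply c_def)
      qed
    qed
    moreover have "(\<Sum>i\<in>{..<k} - T. vsc (dot k (M i) y) (c i)) \<in> vs.span (c ` ({..<k} - T))"
      by (intro vs.span_sum vs.span_scale vs.span_base) auto
    ultimately show "y \<in> vs.span (c ` ({..<k} - T))" by simp
  qed
  then have "vs.dim S \<le> card (c ` ({..<k} - T))" by (intro vs.dim_le_card) auto
  also have "\<dots> \<le> card ({..<k} - T)" by (intro card_image_le) auto
  also have "\<dots> = k - card T" using assms(2) by (simp add: card_Diff_subset finite_subset)
  finally show ?thesis .
qed

text \<open>The columns of \<open>N\<close> are the dual basis \<open>u\<close> of the rows, which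
  settles the product of \<open>m\<close> and \<open>N\<close>. The product in the other order comes
  from expanding unit vectors in \<open>u\<close>, and holds because \<open>k\<close> independent
  rows span \<open>fvec k\<close>.\<close>

lemma independent_rows_inverse:
  fixes m :: "nat \<Rightarrow> nat \<Rightarrow> 'a::field"
  assumes "vs.independent (m ` {..<k})" "inj_on m {..<k}" "m ` {..<k} \<subseteq> fvec k"
  obtains N where "inverse_mats k m N"
proof -
  obtain C where "finite C" "fvec k \<subseteq> vs.span (m ` {..<k} \<union> C)" "card (m ` {..<k}) + card C = k"
    using fvec_basis_extend[OF assms(1,3)] by metis
  then have span: "fvec k \<subseteq> vs.span (m ` {..<k})"
    using card_image[OF assms(2)] by simp
  have "\<exists>u\<in>fvec k. \<forall>i<k. dot k u (m i) = (if i = j then 1 else 0)" for j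
  proof (rule dot_extend[OF assms(1,3), where f="\<lambda>b. if b = m j \<and> j < k then 1 else 0"])
    fix u assume "u \<in> fvec k" "\<And>b. b \<in> m ` {..<k} \<Longrightarrow> dot k u b = (if b = m j \<and> j < k then 1 else 0)"
    then show ?thesis using inj_onD[OF assms(2)] by (intro bexI[of _ u]) auto
  qed
  then obtain u where u: "\<And>j. u j \<in> fvec k" "\<And>i j. i < k \<Longrightarrow> dot k (u j) (m i) = (if i = j then 1 else 0)"
    by metis
  define N where "N r j = u j r" for r j
  have "(\<Sum>r<k. N i r * m r j) = (if i = j then 1 else 0)" if ij: "i < k" "j < k" for i j
  proof -
    have "unit_vec j = (\<Sum>r<k. vsc (m r j) (u r))"
    proof (rule eq_if_dot_eq_spanning[OF _ _ span])
      show "(\<Sum>r<k. vsc (m r j) (u r)) \<in> fvec k"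
        using u(1) by (intro vs.subspace_sum vs.subspace_scale subspace_fvec)
      fix w assume "w \<in> m ` {..<k}"
      then obtain i where i: "i < k" "w = m i" by auto
      have "dot k (\<Sum>r<k. vsc (m r j) (u r)) w = (\<Sum>r<k. if i = r then m r j else 0)"
        unfolding dot_sum_left dot_vsc_left i(2) by (intro sum.cong) (simp_all add: u(2)[OF i(1)])
      also have "\<dots> = dot k (unit_vec j) w"
        using i ij by (simp add: dot_commute[of _ "unit_vec j"] dot_unit_vec_right)
      finally show "dot k (unit_vec j) w = dot k (\<Sum>r<k. vsc (m r j) (u r)) w" by simp
    qed (use ij unit_vec_fvec in auto)
    then have "(\<Sum>r<k. vsc (m r j) (u r)) i = unit_vec j i" by simp
    then show ?thesis by (simp add: sum_fun_apply unit_vec_def N_def mult.commute)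
  qed
  moreover have "(\<Sum>r<k. m i r * N r j) = (if i = j then 1 else 0)" if "i < k" "j < k" for i j
    using u(2)[OF that(1), of j] by (simp add: dot_def N_def mult.commute)
  ultimately show ?thesis using that[of N] by (simp add: inverse_mats_def)
qed

text \<open>Complements turn sums into intersections, so the bound on intersections of the
  \<open>S i\<close> is Rado's condition for spanning sets of the \<open>perp k (S i)\<close>. The
  transversal supplies the rows of \<open>M\<close>.\<close>

theorem transversal_of_perps:
  fixes S :: "nat \<Rightarrow> (nat \<Rightarrow> 'a::field) set"
  assumes S: "\<And>i. i < k \<Longrightarrow> vs.subspace (S i)" "\<And>i. i < k \<Longrightarrow> S i \<subseteq> fvec k"
    and dim: "\<And>J. J \<noteq> {} \<Longrightarrow> J \<subseteq> {..<k} \<Longrightarrow> vs.dim (\<Inter>i\<in>J. S i) \<le> k - card J"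
  obtains M N where "inverse_mats k M N" "\<And>i. i < k \<Longrightarrow> M i \<in> perp k (S i)"
proof -
  have "\<exists>B. finite B \<and> B \<subseteq> perp k (S i) \<and> perp k (S i) \<subseteq> vs.span B" for i
    by (rule fvec_basis_exists[OF perp_fvec]) auto
  then obtain B where B: "\<And>i. finite (B i)" "\<And>i. B i \<subseteq> perp k (S i)" "\<And>i. perp k (S i) \<subseteq> vs.span (B i)"
    by metis
  have span: "vs.span (B i) = perp k (S i)" for i
    using B subspace_perp vs.span_minimal by (metis subset_antisym)
  have "card J \<le> vs.dim (\<Union>i\<in>J. B i)" if J: "J \<subseteq> {..<k}" for J
  proof (cases "J = {}")
    case False
    let ?U = "\<Union>i\<in>J. B i"
    have U: "?U \<subseteq> fvec k" using B(2) perp_fvec by blast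
    have "perp k ?U = (\<Inter>i\<in>J. perp k (B i))"
      using False by (auto simp: perp_def)
    also have "\<dots> = (\<Inter>i\<in>J. S i)"
      using J S by (intro INF_cong refl) (metis lessThan_iff perp_perp perp_span span subsetD)
    finally have "vs.dim (perp k ?U) \<le> k - card J" using dim[OF False J] by simp
    \<comment> \<open>Needed because the subtraction in the bound truncates at zero.\<close>
    moreover have "card J \<le> k" using card_mono[OF _ J] by simp
    ultimately show ?thesis using dim_perp_add[OF U] by linarith
  qed simp
  then obtain m where m: "\<forall>i\<in>{..<k}. m i \<in> B i" "inj_on m {..<k}" "vs.independent (m ` {..<k})"
    using vs.rado_independent_transversal[of "{..<k}" B] B(1) by auto
  have mem: "m i \<in> perp k (S i)" if "i < k" for i using m(1) B(2) that by blast
  then have "m ` {..<k} \<subseteq> fvec k" using perp_fvec by blast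
  then obtain N where "inverse_mats k m N" using independent_rows_inverse m by blast
  then show ?thesis using that mem by blast
qed

section \<open>Specialisation of the generic matrix\<close>

text \<open>The target is only a commutative ring because the locale is also interpreted for the
  constants of a polynomial ring in \<open>t\<close> over \<open>K\<close>.\<close>

locale scalar_hom =
  fixes emb :: "'q::field \<Rightarrow> 'f::comm_ring_1"
  assumes emb_1: "emb 1 = 1"
    and emb_add: "emb (a + b) = emb a + emb b"
    and emb_mult: "emb (a * b) = emb a * emb b"
begin

lemma emb_0: "emb 0 = 0"
  using emb_add[of 0 0] by simp

lemma emb_diff: "emb (a - b) = emb a - emb b"
  using emb_add[of "a - b" b] by simp

lemma emb_sum: "emb (\<Sum>a\<in>A. f a) = (\<Sum>a\<in>A. emb (f a))"
  by (induction A rule: infinite_finite_induct) (simp_all add: emb_0 emb_add)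

end

section \<open>Substitution into multivariate polynomials\<close>

definition eval_monom :: "('v \<Rightarrow> 'f::comm_ring_1) \<Rightarrow> ('v \<Rightarrow>\<^sub>0 nat) \<Rightarrow> 'f" where
  "eval_monom y m = (\<Prod>x\<in>Poly_Mapping.keys m. y x ^ Poly_Mapping.lookup m x)"

definition eval_mpoly :: "('q::field \<Rightarrow> 'f::comm_ring_1) \<Rightarrow> ('v \<Rightarrow> 'f) \<Rightarrow> (('v \<Rightarrow>\<^sub>0 nat) \<Rightarrow>\<^sub>0 'q) \<Rightarrow> 'f" where
  "eval_mpoly h y p = (\<Sum>m\<in>Poly_Mapping.keys p. h (Poly_Mapping.lookup p m) * eval_monom y m)"

lemma eval_monom_superset:
  assumes "finite A" "Poly_Mapping.keys m \<subseteq> A"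
  shows "eval_monom y m = (\<Prod>x\<in>A. y x ^ Poly_Mapping.lookup m x)"
  unfolding eval_monom_def using assms
  by (intro prod.mono_neutral_left) (auto simp: in_keys_iff)

lemma eval_monom_add: "eval_monom y (m + m') = eval_monom y m * eval_monom y m'"
proof -
  let ?A = "Poly_Mapping.keys m \<union> Poly_Mapping.keys m'"
  show ?thesis
    using keys_add[of m m'] eval_monom_superset[of ?A m y] eval_monom_superset[of ?A m' y]
      eval_monom_superset[of ?A "m + m'" y]
    by (simp add: lookup_add power_add prod.distrib)
qed

lemma eval_monom_single: "eval_monom y (Poly_Mapping.single x 1) = y x"
  by (simp add: eval_monom_def)

lemma mpoly_eq_sum: "p = (\<Sum>m\<in>Poly_Mapping.keys p. Poly_Mapping.single m (Poly_Mapping.lookup p m))"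
  by (rule poly_mapping_eqI) (simp add: lookup_sum lookup_single when_def in_keys_iff)

lemma prod_single_power:
  "(\<Prod>x\<in>A. Poly_Mapping.single (Poly_Mapping.single x 1) (1::'q::field) ^ f x) =
     Poly_Mapping.single (\<Sum>x\<in>A. Poly_Mapping.single x (f x :: nat)) 1"
proof -
  have pow: "Poly_Mapping.single (Poly_Mapping.single x 1) (1::'q) ^ n = Poly_Mapping.single (Poly_Mapping.single x n) 1"
    for x :: 'b and n :: nat
    by (induction n) (simp_all add: mult_single single_add[symmetric] del: single_one, simp)
  show ?thesis
    unfolding pow by (induction A rule: infinite_finite_induct) (simp_all add: mult_single)
qed

context scalar_hom
begin

lemma eval_mpoly_0: "eval_mpoly emb y 0 = 0"
  by (simp add: eval_mpoly_def)

lemma eval_mpoly_add: "eval_mpoly emb y (p + q) = eval_mpoly emb y p + eval_mpoly emb y q"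
  unfolding eval_mpoly_def
  by (rule setsum_keys_plus_distrib) (simp_all add: emb_0 emb_add distrib_right)

lemma eval_mpoly_sum: "eval_mpoly emb y (\<Sum>a\<in>A. f a) = (\<Sum>a\<in>A. eval_mpoly emb y (f a))"
  by (induction A rule: infinite_finite_induct) (simp_all add: eval_mpoly_0 eval_mpoly_add)

lemma eval_mpoly_single: "eval_mpoly emb y (Poly_Mapping.single m c) = emb c * eval_monom y m"
  by (simp add: eval_mpoly_def emb_0)

lemma eval_mpoly_mult: "eval_mpoly emb y (p * q) = eval_mpoly emb y p * eval_mpoly emb y q"
proof -
  let ?s = "\<lambda>p m. Poly_Mapping.single m (Poly_Mapping.lookup p m) :: ('b \<Rightarrow>\<^sub>0 nat) \<Rightarrow>\<^sub>0 'q"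
  have "p * q = (\<Sum>m\<in>Poly_Mapping.keys p. ?s p m) * (\<Sum>m\<in>Poly_Mapping.keys q. ?s q m)"
    using mpoly_eq_sum[of p] mpoly_eq_sum[of q] by simp
  then have "eval_mpoly emb y (p * q) =
      (\<Sum>m\<in>Poly_Mapping.keys p. \<Sum>m'\<in>Poly_Mapping.keys q. eval_mpoly emb y (?s p m * ?s q m'))"
    by (simp add: sum_product eval_mpoly_sum)
  also have "\<dots> = eval_mpoly emb y p * eval_mpoly emb y q"
    by (simp add: eval_mpoly_def[of _ _ p] eval_mpoly_def[of _ _ q] sum_product mult_single
        eval_mpoly_single emb_mult eval_monom_add mult_ac)
  finally show ?thesis .
qed

end

section \<open>Polynomials inside the rational function field\<close>

abbreviation to_K :: "((nat \<times> nat \<Rightarrow>\<^sub>0 nat) \<Rightarrow>\<^sub>0 'q::field) \<Rightarrow> 'q ratfun" where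
  "to_K p \<equiv> Fract p 1"

lemma to_K_add: "to_K (p + q) = to_K p + to_K q"
  and to_K_mult: "to_K (p * q) = to_K p * to_K q"
  and to_K_0: "to_K 0 = 0"
  and to_K_1: "to_K 1 = 1"
  by (simp_all add: fract_collapse)

lemma to_K_eq_0_iff: "to_K p = 0 \<longleftrightarrow> p = 0"
  by (simp add: Zero_fract_def eq_fract)

lemma to_K_sum: "to_K (\<Sum>a\<in>A. f a) = (\<Sum>a\<in>A. to_K (f a))"
  by (induction A rule: infinite_finite_induct) (simp_all add: to_K_0 to_K_add del: add_fract)

lemma to_K_prod: "to_K (\<Prod>a\<in>A. f a) = (\<Prod>a\<in>A. to_K (f a))"
  by (induction A rule: infinite_finite_induct) (simp_all add: to_K_1 to_K_mult del: mult_fract)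

lemma to_K_power: "to_K (p ^ n) = to_K p ^ n"
  by (induction n) (simp_all add: to_K_1 to_K_mult del: mult_fract)

interpretation constK: scalar_hom "constK :: 'q::field \<Rightarrow> 'q ratfun"
  by unfold_locales (simp_all add: constK_def fract_collapse single_add mult_single)

abbreviation indet :: "nat \<times> nat \<Rightarrow> ((nat \<times> nat \<Rightarrow>\<^sub>0 nat) \<Rightarrow>\<^sub>0 'q::field)" where
  "indet x \<equiv> Poly_Mapping.single (Poly_Mapping.single x 1) 1"

text \<open>Constants go to constants and variables to themselves, so this substitution is the
  inclusion into \<open>K\<close>. It identifies the value at \<open>t = 1\<close> of a polynomial
  moved along a line, and so shows that a nonzero polynomial stays nonzero.\<close>

lemma eval_mpoly_Zmat: "eval_mpoly constK (\<lambda>x. Zmat (fst x) (snd x)) p = to_K p"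
proof -
  have mono: "eval_monom (\<lambda>x. Zmat (fst x) (snd x)) m = to_K (Poly_Mapping.single m (1::'a))" for m
  proof -
    have "eval_monom (\<lambda>x. Zmat (fst x) (snd x)) m =
        to_K (\<Prod>x\<in>Poly_Mapping.keys m. indet x ^ Poly_Mapping.lookup m x :: _ \<Rightarrow>\<^sub>0 'a)"
      by (simp add: eval_monom_def Zmat_def to_K_prod to_K_power)
    also have "\<dots> = to_K (Poly_Mapping.single m 1)"
      using mpoly_eq_sum[of m] by (simp only: prod_single_power)
    finally show ?thesis .
  qed
  have "eval_mpoly constK (\<lambda>x. Zmat (fst x) (snd x)) p =
      to_K (\<Sum>m\<in>Poly_Mapping.keys p. Poly_Mapping.single m (Poly_Mapping.lookup p m))"
    by (simp add: eval_mpoly_def mono constK_def mult_single to_K_sum)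
  then show ?thesis using mpoly_eq_sum[of p] by simp
qed

lemma common_denominator:
  fixes x :: "'b \<Rightarrow> 'q::field ratfun"
  assumes "finite B"
  obtains D p where "D \<noteq> 0" "\<And>b. b \<in> B \<Longrightarrow> x b * to_K D = to_K (p b)"
proof -
  have "\<exists>p d. x b = Fract p d \<and> d \<noteq> 0" for b by (cases "x b") auto
  then obtain p d where pd: "\<And>b. x b = Fract (p b) (d b)" "\<And>b. d b \<noteq> 0" by metis
  define D where "D = (\<Prod>b\<in>B. d b)"
  have "x b * to_K D = to_K (p b * (\<Prod>c\<in>B - {b}. d c))" if "b \<in> B" for b
  proof -
    have "D = d b * (\<Prod>c\<in>B - {b}. d c)" unfolding D_def using assms that by (rule prod.remove)
    then have "p b * D = p b * (\<Prod>c\<in>B - {b}. d c) * d b" by (simp only: mult_ac)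
    then show ?thesis unfolding pd(1) using pd(2) by (simp add: eq_fract)
  qed
  moreover have "D \<noteq> 0" using pd(2) assms by (simp add: D_def)
  ultimately show ?thesis by (intro that[of D]) simp_all
qed

text \<open>Move the matrix \<open>Z\<close> to \<open>U\<close> along the line \<open>U + t (Z - U)\<close>. Evaluation at \<open>t = 1\<close> shows that the
  coefficients of a polynomial kernel vector survive in \<open>K[t]\<close>; their coefficients at the lowest
  occurring power of \<open>t\<close> form a kernel vector at \<open>U\<close>.\<close>

theorem generic_kernel_trivial:
  fixes a :: "'r \<Rightarrow> 'b \<Rightarrow> nat \<times> nat \<Rightarrow> 'q::field" and U :: "nat \<times> nat \<Rightarrow> 'q ratfun"
  assumes fin: "finite B"
    and triv: "\<And>x b. (\<And>r. r \<in> R \<Longrightarrow> (\<Sum>b\<in>B. x b * (\<Sum>s\<in>P. constK (a r b s) * U s)) = 0) \<Longrightarrow> b \<in> B \<Longrightarrow> x b = 0"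
    and eq: "\<And>r. r \<in> R \<Longrightarrow> (\<Sum>b\<in>B. x b * (\<Sum>s\<in>P. constK (a r b s) * Zmat (fst s) (snd s))) = 0"
    and b: "b \<in> B"
  shows "x b = 0"
proof (rule ccontr)
  assume nz: "x b \<noteq> 0"
  \<comment> \<open>Denominators are cleared because only polynomials can be substituted
    into.\<close>
  obtain D p where D: "D \<noteq> 0" "\<And>b. b \<in> B \<Longrightarrow> x b * to_K D = to_K (p b)"
    using common_denominator[OF fin] by metis
  define h :: "'q \<Rightarrow> 'q ratfun poly" where "h c = [:constK c:]" for c
  define y where "y s = [:U s, Zmat (fst s) (snd s) - U s:]" for s
  interpret h: scalar_hom h
    by unfold_locales (simp_all add: h_def constK.emb_1 constK.emb_add constK.emb_mult one_pCons)
  define g where "g b = eval_mpoly h y (p b)" for b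
  have "poly (eval_mpoly h y q) 1 = to_K q" for q
  proof -
    have "poly (eval_mpoly h y q) 1 = eval_mpoly constK (\<lambda>x. Zmat (fst x) (snd x)) q"
      by (simp add: eval_mpoly_def eval_monom_def poly_sum poly_prod h_def y_def)
    then show ?thesis by (simp only: eval_mpoly_Zmat)
  qed
  moreover have "to_K (p b) \<noteq> 0"
    using D(2)[OF b] D(1) nz to_K_eq_0_iff[of D] by (metis mult_eq_0_iff)
  ultimately have "g b \<noteq> 0" unfolding g_def by (metis poly_0)
  then have ex: "\<exists>m. \<exists>b\<in>B. coeff (g b) m \<noteq> 0"
    using b by (metis leading_coeff_0_iff)
  define m where "m = (LEAST m. \<exists>b\<in>B. coeff (g b) m \<noteq> 0)"
  have m: "\<exists>b\<in>B. coeff (g b) m \<noteq> 0" unfolding m_def by (rule LeastI_ex[OF ex])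
  have low: "coeff (g b) i = 0" if "i < m" "b \<in> B" for i b
    using not_less_Least[OF that(1)[unfolded m_def]] that(2) by blast
  have "(\<Sum>b\<in>B. coeff (g b) m * (\<Sum>s\<in>P. constK (a r b s) * U s)) = 0" if r: "r \<in> R" for r
  proof -
    \<comment> \<open>The equation over \<open>K\<close> is first pulled back to the polynomial ring
      along the injective \<open>to_K\<close>; there the substitution \<open>y\<close>
      applies.\<close>
    define L where "L b = (\<Sum>s\<in>P. Poly_Mapping.single 0 (a r b s) * indet s)" for b
    have L: "to_K (L b) = (\<Sum>s\<in>P. constK (a r b s) * Zmat (fst s) (snd s))" for b
      by (simp add: L_def to_K_sum to_K_mult constK_def Zmat_def del: mult_fract)
    have "to_K (\<Sum>b\<in>B. p b * L b) = (\<Sum>b\<in>B. x b * to_K D * to_K (L b))"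
      unfolding to_K_sum to_K_mult using D(2) by (intro sum.cong) simp_all
    also have "\<dots> = to_K D * (\<Sum>b\<in>B. x b * to_K (L b))"
      by (simp only: sum_distrib_left mult_ac)
    also have "\<dots> = 0" unfolding L eq[OF r] by simp
    finally have "(\<Sum>b\<in>B. p b * L b) = 0" by (simp only: to_K_eq_0_iff)
    then have "0 = eval_mpoly h y (\<Sum>b\<in>B. p b * L b)" by (simp add: h.eval_mpoly_0)
    also have "\<dots> = (\<Sum>b\<in>B. g b * (\<Sum>s\<in>P. h (a r b s) * y s))"
      by (simp add: g_def h.eval_mpoly_sum h.eval_mpoly_mult L_def h.eval_mpoly_single
          eval_monom_single h.emb_1 eval_monom_def[of _ 0] del: One_nat_def)
    finally have "0 = coeff (\<Sum>b\<in>B. g b * (\<Sum>s\<in>P. h (a r b s) * y s)) m" by simp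
    also have "\<dots> = (\<Sum>b\<in>B. coeff (g b * (\<Sum>s\<in>P. h (a r b s) * y s)) m)"
      by (rule coeff_sum)
    also have "\<dots> = (\<Sum>b\<in>B. coeff (g b) m * (\<Sum>s\<in>P. constK (a r b s) * U s))"
    proof (rule sum.cong[OF refl])
      fix b assume b: "b \<in> B"
      let ?q = "\<Sum>s\<in>P. h (a r b s) * y s"
      have "coeff (g b * ?q) m = (\<Sum>i\<le>m. coeff (g b) i * coeff ?q (m - i))"
        by (rule coeff_mult)
      \<comment> \<open>By minimality of \<open>m\<close> only the term \<open>i = m\<close> of the
        Cauchy product survives. It multiplies the constant coefficient of \<open>?q\<close>, that
        is, the value at \<open>t = 0\<close>, where the matrix is \<open>U\<close>.\<close>
      also have "\<dots> = (\<Sum>i\<in>{m}. coeff (g b) i * coeff ?q (m - i))"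
        using low[OF _ b] by (intro sum.mono_neutral_right) auto
      also have "\<dots> = coeff (g b) m * coeff ?q 0" by simp
      also have "coeff ?q 0 = (\<Sum>s\<in>P. constK (a r b s) * U s)"
        by (simp add: coeff_sum h_def y_def mult.commute)
      finally show "coeff (g b * ?q) m = coeff (g b) m * (\<Sum>s\<in>P. constK (a r b s) * U s)" .
    qed
    finally show ?thesis by simp
  qed
  then have "\<forall>b\<in>B. coeff (g b) m = 0" using triv[where x="\<lambda>b. coeff (g b) m"] by blast
  then show False using m by blast
qed

section \<open>Attained kernel patterns\<close>

lemma Fq_subspace_iff: "Fq_subspace n V \<longleftrightarrow> vs.subspace V \<and> V \<subseteq> fvec n"
  by (auto simp: Fq_subspace_def fvec_def)

lemma vec_zero_eq: "(\<lambda>_. 0) = (0 :: nat \<Rightarrow> 'a::zero)"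
  by (simp add: fun_eq_iff)

lemma dim_zero_space: "vs.dim {0} = 0"
  by (rule vs.dim_unique[of "{}"]) (auto simp: vs.independent_empty)

text \<open>The projection to the coordinates outside \<open>J\<close> is injective on
  \<open>S\<close>. The count is made dually: \<open>perp k S\<close> and the unit vectors outside
  \<open>J\<close> together span the whole space.\<close>

lemma dim_le_if_coordinates_detect:
  fixes S :: "(nat \<Rightarrow> 'a::field) set"
  assumes "vs.subspace S" "S \<subseteq> fvec k" "J \<subseteq> {..<k}"
    and zero: "\<And>y. y \<in> S \<Longrightarrow> (\<And>r. r < k \<Longrightarrow> r \<notin> J \<Longrightarrow> y r = 0) \<Longrightarrow> y = 0"
  shows "vs.dim S \<le> k - card J"
proof -
  obtain A where A: "finite A" "A \<subseteq> perp k S" "vs.independent A" "perp k S \<subseteq> vs.span A" "card A = vs.dim (perp k S)"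
    using fvec_basis_exists[OF perp_fvec] .
  let ?E = "unit_vec ` ({..<k} - J) :: (nat \<Rightarrow> 'a) set"
  have "perp k (A \<union> ?E) \<subseteq> {0}"
  proof
    fix y assume y: "y \<in> perp k (A \<union> ?E)"
    then have "y \<in> perp k A" by (auto simp: perp_def)
    moreover have "vs.span A = perp k S" using A(2,4) vs.span_subspace[OF A(2,4) subspace_perp] by simp
    ultimately have "y \<in> S" using perp_perp[OF assms(1,2)] perp_span by metis
    moreover have "y r = 0" if "r < k" "r \<notin> J" for r
      using y that dot_unit_vec_right[OF that(1), of y] by (auto simp: perp_def)
    ultimately show "y \<in> {0}" using zero by blast
  qed
  then have "vs.dim (perp k (A \<union> ?E)) \<le> 0"
    using vs.dim_le_card[of "perp k (A \<union> ?E)" "{}"] by simp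
  moreover have "A \<union> ?E \<subseteq> fvec k"
    using A(2) perp_fvec[of k S] unit_vec_fvec by blast
  ultimately have "k = vs.dim (A \<union> ?E)" using dim_perp_add[of "A \<union> ?E" k] by simp
  also have "\<dots> \<le> card (A \<union> ?E)" using A(1) by (intro vs.dim_le_card') auto
  also have "\<dots> \<le> card A + card ?E" by (rule card_Un_le)
  also have "card ?E \<le> card ({..<k} - J)" by (rule card_image_le) simp
  also have "\<dots> = k - card J" using assms(3) by (simp add: card_Diff_subset finite_subset)
  finally have "k \<le> vs.dim (perp k S) + (k - card J)" using A(5) by simp
  then show ?thesis using dim_perp_add[OF assms(2)] by linarith
qed

section \<open>Column spans and attainment\<close>

definition colvec :: "('q::field \<Rightarrow> 'f::field) \<Rightarrow> (nat \<Rightarrow> nat \<Rightarrow> 'f) \<Rightarrow> nat \<Rightarrow> nat \<Rightarrow> (nat \<Rightarrow> 'q) \<Rightarrow> nat \<Rightarrow> 'f" where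
  "colvec emb G k n v = (\<lambda>i. if i < k then (\<Sum>j<n. G i j * emb (v j)) else 0)"

text \<open>For \<open>k \<le> n\<close> and a generator matrix of full rank this is equivalent to
  MRD. In this form it also applies to \<open>Zmat\<close> and to its specialisations.\<close>

definition rank_preserving :: "('q::field \<Rightarrow> 'f::field) \<Rightarrow> (nat \<Rightarrow> nat \<Rightarrow> 'f) \<Rightarrow> nat \<Rightarrow> nat \<Rightarrow> bool" where
  "rank_preserving emb G k n \<longleftrightarrow>
     (\<forall>V. Fq_subspace n V \<and> vs.dim V \<le> k \<longrightarrow> vs.dim (Gspan emb G k n V) = vs.dim V)"

lemma Gspan_eq: "Gspan emb G k n V = vs.span (colvec emb G k n ` V)"
  by (simp add: Gspan_def colvec_def)

lemma colvec_fvec: "colvec emb G k n v \<in> fvec k"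
  by (simp add: colvec_def fvec_def)

lemma Gspan_subspace: "vs.subspace (Gspan emb G k n V)"
  by (simp add: Gspan_eq)

lemma Gspan_fvec: "Gspan emb G k n V \<subseteq> fvec k"
  unfolding Gspan_eq by (rule vs.span_minimal) (auto simp: colvec_fvec subspace_fvec)

lemma dot_colvec: "dot k m (colvec emb G k n v) = (\<Sum>j<n. (\<Sum>r<k. m r * G r j) * emb (v j))"
proof -
  have "dot k m (colvec emb G k n v) = (\<Sum>r<k. \<Sum>j<n. m r * G r j * emb (v j))"
    by (simp add: dot_def colvec_def sum_distrib_left mult.assoc)
  then show ?thesis by (simp add: sum.swap[of _ "{..<n}"] sum_distrib_right)
qed

lemma attains_iff:
  "attains emb G k n V \<longleftrightarrow>
     (\<exists>M N. inverse_mats k M N \<and> (\<forall>i<k. \<forall>v\<in>V i. dot k (M i) (colvec emb G k n v) = 0))"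
  by (simp add: attains_def inverse_mats_def dot_colvec conj_assoc)

lemma dot_Gspan_zero:
  assumes "\<And>v. v \<in> V \<Longrightarrow> dot k m (colvec emb G k n v) = 0" "y \<in> Gspan emb G k n V"
  shows "dot k m y = 0"
proof -
  have "Gspan emb G k n V \<subseteq> {y. dot k m y = 0}"
    unfolding Gspan_eq using assms(1) by (intro vs.span_minimal subspace_dot_zero) auto
  then show ?thesis using assms(2) by blast
qed

lemma attains_if_dim_Inter_le:
  assumes "\<And>J. J \<noteq> {} \<Longrightarrow> J \<subseteq> {..<k} \<Longrightarrow> vs.dim (\<Inter>i\<in>J. Gspan emb G k n (V i)) \<le> k - card J"
  shows "attains emb G k n V"
proof -
  obtain M N where MN: "inverse_mats k M N" "\<And>i. i < k \<Longrightarrow> M i \<in> perp k (Gspan emb G k n (V i))"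
    using transversal_of_perps[of k "\<lambda>i. Gspan emb G k n (V i)"] Gspan_subspace Gspan_fvec assms
    by metis
  have "dot k (M i) (colvec emb G k n v) = 0" if "i < k" "v \<in> V i" for i v
    using MN(2)[OF that(1)] vs.span_base[of "colvec emb G k n v" "colvec emb G k n ` V i"] that(2)
    by (auto simp: perp_def Gspan_eq)
  then show ?thesis using MN(1) attains_iff by blast
qed

text \<open>The rows of \<open>M\<close> with index in \<open>J\<close> kill the column span of the
  intersection of the \<open>V i\<close>, so this span has dimension at most
  \<open>k - card J\<close>; rank preservation carries the bound back to the intersection
  itself.\<close>

lemma is_GKP_if_attains:
  assumes rp: "rank_preserving emb G k n" and att: "attains emb G k n V"
    and V: "\<And>i. i < k \<Longrightarrow> Fq_subspace n (V i)" "\<And>i. i < k \<Longrightarrow> vs.dim (V i) \<le> k"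
  shows "is_GKP k n V"
proof -
  obtain M N where MN: "inverse_mats k M N" "\<And>i v. i < k \<Longrightarrow> v \<in> V i \<Longrightarrow> dot k (M i) (colvec emb G k n v) = 0"
    using att unfolding attains_iff by blast
  have "vs.dim (\<Inter>i\<in>J. V i) \<le> k - card J" if J: "J \<noteq> {}" "J \<subseteq> {..<k}" for J
  proof -
    let ?I = "\<Inter>i\<in>J. V i"
    obtain i0 where i0: "i0 \<in> J" using J by blast
    have V0: "Fq_subspace n (V i0)" "vs.dim (V i0) \<le> k" using V i0 J by auto
    have sub: "?I \<subseteq> V i0" using i0 by blast
    have "vs.subspace ?I" using V J Fq_subspace_iff by (intro vs.subspace_Int) blast
    then have I: "Fq_subspace n ?I" using sub V0 unfolding Fq_subspace_iff by blast
    have "vs.dim ?I \<le> vs.dim (V i0)"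
      by (rule dim_subset_fvec[OF sub]) (use V0 in \<open>auto simp: Fq_subspace_iff\<close>)
    then have "vs.dim ?I = vs.dim (Gspan emb G k n ?I)"
      using rp I V0 unfolding rank_preserving_def by (metis order_trans)
    also have "\<dots> \<le> k - card J"
    proof (rule dim_common_kernel_le[OF MN(1) J(2) Gspan_fvec])
      fix y i assume y: "y \<in> Gspan emb G k n ?I" and i: "i \<in> J"
      then show "dot k (M i) y = 0"
        using J MN(2) by (intro dot_Gspan_zero[OF _ y]) blast
    qed
    finally show ?thesis .
  qed
  then show ?thesis using V by (simp add: is_GKP_def)
qed

lemma is_GKP_dim_Inter_le:
  assumes "is_GKP k n V" "J \<noteq> {}" "J \<subseteq> {..<k}"
  shows "vs.dim (\<Inter>i\<in>J. V i) \<le> k - card J"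
  using assms by (simp add: is_GKP_def)

lemma is_GKP_dim_le: "is_GKP k n V \<Longrightarrow> i < k \<Longrightarrow> vs.dim (V i) \<le> k"
  using is_GKP_dim_Inter_le[of k n V "{i}"] by simp

text \<open>A basis of \<open>\<Sum>\<^sub>j (G\<^bsub>V j\<^esub>)\<^sup>\<bottom>\<close> chosen from the summands, padded with zero subspaces, is a pattern
  attained by \<open>G\<close>, hence a GKP, hence attained by \<open>H\<close>.\<close>

lemma dim_Inter_Gspan_le:
  fixes emb :: "'q::field \<Rightarrow> 'f::field" and emb' :: "'q \<Rightarrow> 'g::field"
  assumes emb0: "emb 0 = 0" and rp: "rank_preserving emb G k n"
    and att: "\<And>V. is_GKP k n V \<Longrightarrow> kp_order k V \<le> l \<Longrightarrow> attains emb' H k n V"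
    and l: "1 \<le> l" and V: "\<And>j. j < l \<Longrightarrow> Fq_subspace n (V j)" "\<And>j. j < l \<Longrightarrow> vs.dim (V j) \<le> k"
  shows "vs.dim (\<Inter>j<l. Gspan emb' H k n (V j)) \<le> vs.dim (\<Inter>j<l. Gspan emb G k n (V j))"
proof -
  let ?S = "\<Union>j<l. perp k (Gspan emb G k n (V j))"
  have S: "?S \<subseteq> fvec k" using perp_fvec by blast
  obtain B where B: "finite B" "B \<subseteq> ?S" "vs.independent B" "?S \<subseteq> vs.span B" "card B = vs.dim ?S"
    using fvec_basis_exists[OF S] .
  obtain C where C: "finite C" "C \<subseteq> fvec k" "B \<inter> C = {}" "vs.independent (B \<union> C)"
    "fvec k \<subseteq> vs.span (B \<union> C)" "card B + card C = k"
    using fvec_basis_extend[OF B(3) order_trans[OF B(2) S]] .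
  define s where "s = card B"
  have sk: "s \<le> k" using C(6) s_def by simp
  have "perp k ?S = (\<Inter>j<l. perp k (perp k (Gspan emb G k n (V j))))"
  proof -
    \<comment> \<open>Over an empty index set the intersection would be the whole function type and
      not \<open>fvec k\<close>.\<close>
    have "0 \<in> {..<l}" using l by simp
    then show ?thesis unfolding perp_def by blast
  qed
  also have "\<dots> = (\<Inter>j<l. Gspan emb G k n (V j))"
    by (simp add: perp_perp Gspan_subspace Gspan_fvec)
  finally have dimG: "vs.dim (\<Inter>j<l. Gspan emb G k n (V j)) = k - s"
    using dim_perp_add[OF S] B(5) s_def by simp
  obtain f where f: "bij_betw f {..<s} B"
    using ex_bij_betw_nat_finite[OF B(1)] s_def atLeast0LessThan by metis
  obtain g where g: "bij_betw g {s..<k} C"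
    using finite_same_card_bij[of "{s..<k}" C] C(1,6) s_def by auto
  \<comment> \<open>The chosen basis \<open>B\<close> comes first and is completed by
    \<open>C\<close> to the rows of an invertible matrix.\<close>
  define m where "m i = (if i < s then f i else g i)" for i
  have "bij_betw m ({..<s} \<union> {s..<k}) (B \<union> C)"
  proof (rule bij_betw_combine[OF _ _ C(3)])
    show "bij_betw m {..<s} B" using f by (rule bij_betw_cong[THEN iffD1, rotated]) (simp add: m_def)
    show "bij_betw m {s..<k} C" using g by (rule bij_betw_cong[THEN iffD1, rotated]) (simp add: m_def)
  qed
  then have m: "bij_betw m {..<k} (B \<union> C)" using sk by (simp add: ivl_disj_un)
  have BC: "B \<union> C \<subseteq> fvec k" using B(2) C(2) S by blast
  obtain N where N: "inverse_mats k m N"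
    using independent_rows_inverse[of m k] m C(4) BC by (auto simp: bij_betw_def)
  have "\<exists>j<l. m i \<in> perp k (Gspan emb G k n (V j))" if "i < s" for i
    using B(2) f that by (auto simp: m_def bij_betw_def)
  then obtain jj where jj: "\<And>i. i < s \<Longrightarrow> jj i < l" "\<And>i. i < s \<Longrightarrow> m i \<in> perp k (Gspan emb G k n (V (jj i)))"
    by metis
  \<comment> \<open>The filler rows get the zero subspace, which imposes no condition on them and
    does not count towards the order.\<close>
  define V' where "V' i = (if i < s then V (jj i) else {0})" for i
  have "attains emb G k n V'"
    unfolding attains_iff
  proof (intro exI conjI allI impI ballI)
    show "inverse_mats k m N" by (rule N)
    fix i v assume i: "i < k" "v \<in> V' i"
    show "dot k (m i) (colvec emb G k n v) = 0"
    proof (cases "i < s")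
      case True
      then show ?thesis
        using jj(2)[OF True] i(2) vs.span_base[of "colvec emb G k n v" "colvec emb G k n ` V (jj i)"]
        by (auto simp: perp_def Gspan_eq V'_def)
    next
      case False
      then have "colvec emb G k n v = 0" using i(2) emb0 by (simp add: V'_def colvec_def fun_eq_iff)
      then show ?thesis by simp
    qed
  qed
  moreover have "Fq_subspace n (V' i) \<and> vs.dim (V' i) \<le> k" for i
    using V jj(1) by (auto simp: V'_def dim_zero_space Fq_subspace_iff fvec_def)
  ultimately have gkp: "is_GKP k n V'" using is_GKP_if_attains[OF rp] by blast
  have "V' ` {..<k} - {{\<lambda>_. 0}} \<subseteq> V ` {..<l}"
    using jj(1) by (auto simp: V'_def vec_zero_eq split: if_splits)
  then have "kp_order k V' \<le> card (V ` {..<l})"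
    unfolding kp_order_def by (intro card_mono) auto
  also have "\<dots> \<le> l" using card_image_le[of "{..<l}" V] by simp
  finally obtain M N where MN: "inverse_mats k M N" "\<And>i v. i < k \<Longrightarrow> v \<in> V' i \<Longrightarrow> dot k (M i) (colvec emb' H k n v) = 0"
    using att[OF gkp] unfolding attains_iff by blast
  \<comment> \<open>Each of the first \<open>s\<close> rows of \<open>M\<close> kills one of the
    intersected spans, hence the intersection. The resulting bound \<open>k - s\<close> is the
    dimension for \<open>G\<close> by \<open>dimG\<close>.\<close>
  have "vs.dim (\<Inter>j<l. Gspan emb' H k n (V j)) \<le> k - card {..<s}"
  proof (rule dim_common_kernel_le[OF MN(1)])
    show "{..<s} \<subseteq> {..<k}" using sk by auto
    show "(\<Inter>j<l. Gspan emb' H k n (V j)) \<subseteq> fvec k" using l Gspan_fvec[of emb' H k n "V 0"] by force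
    fix y i assume y: "y \<in> (\<Inter>j<l. Gspan emb' H k n (V j))" and "i \<in> {..<s}"
    then have i: "i < s" "i < k" using sk by auto
    show "dot k (M i) y = 0"
    proof (rule dot_Gspan_zero)
      show "y \<in> Gspan emb' H k n (V' i)" using y jj(1)[OF i(1)] i(1) by (simp add: V'_def)
    qed (rule MN(2)[OF i(2)])
  qed
  then show ?thesis using dimG by simp
qed

section \<open>MRD codes and dimensions of column spans\<close>

lemma colvec_sum_eq_0_iff:
  "(\<Sum>b\<in>B. vsc (x b) (colvec emb G k n b)) = 0 \<longleftrightarrow>
     (\<forall>r<k. (\<Sum>b\<in>B. x b * (\<Sum>j<n. G r j * emb (b j))) = 0)"
proof -
  have "(\<Sum>b\<in>B. vsc (x b) (colvec emb G k n b)) r =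
      (if r < k then \<Sum>b\<in>B. x b * (\<Sum>j<n. G r j * emb (b j)) else 0)" for r
    by (simp add: sum_fun_apply colvec_def)
  then show ?thesis by (simp add: fun_eq_iff)
qed

locale field_hom = scalar_hom emb for emb :: "'q::field \<Rightarrow> 'f::field"
begin

lemma colvec_0: "colvec emb G k n 0 = 0"
  by (simp add: colvec_def fun_eq_iff emb_0)

lemma colvec_add: "colvec emb G k n (v + w) = colvec emb G k n v + colvec emb G k n w"
  by (simp add: colvec_def fun_eq_iff emb_add distrib_left sum.distrib)

lemma colvec_vsc: "colvec emb G k n (vsc c v) = vsc (emb c) (colvec emb G k n v)"
  by (simp add: colvec_def fun_eq_iff emb_mult sum_distrib_left mult.left_commute)

lemma Gspan_subset_span:
  assumes "V \<subseteq> vs.span B"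
  shows "Gspan emb G k n V \<subseteq> vs.span (colvec emb G k n ` B)"
proof -
  let ?c = "colvec emb G k n"
  have "vs.span B \<subseteq> {v. ?c v \<in> vs.span (?c ` B)}"
    by (rule vs.span_minimal)
      (auto simp: vs.subspace_def colvec_0 colvec_add colvec_vsc vs.span_zero intro: vs.span_base vs.span_add vs.span_scale)
  then show ?thesis
    unfolding Gspan_eq using assms by (intro vs.span_minimal vs.subspace_span) blast
qed

lemma Gspan_eq_span_basis:
  assumes "B \<subseteq> V" "V \<subseteq> vs.span B"
  shows "Gspan emb G k n V = vs.span (colvec emb G k n ` B)"
  using Gspan_subset_span[OF assms(2)] Gspan_eq vs.span_mono[OF image_mono[OF assms(1)]] by blast

text \<open>Brings rank preservation into the form of linear systems with trivial kernel, the form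
  that passes from a special matrix to the generic one.\<close>

lemma rank_preservingI:
  assumes triv: "\<And>B x b. \<lbrakk>vs.independent B; B \<subseteq> fvec n; card B \<le> k; finite B;
      \<And>r. r < k \<Longrightarrow> (\<Sum>b\<in>B. x b * (\<Sum>j<n. G r j * emb (b j))) = 0; b \<in> B\<rbrakk> \<Longrightarrow> x b = (0::'f)"
  shows "rank_preserving emb G k n"
  unfolding rank_preserving_def
proof (intro allI impI)
  fix V :: "(nat \<Rightarrow> 'q) set" assume V: "Fq_subspace n V \<and> vs.dim V \<le> k"
  let ?c = "colvec emb G k n"
  obtain B where B: "finite B" "B \<subseteq> V" "vs.independent B" "V \<subseteq> vs.span B" "card B = vs.dim V"
    using fvec_basis_exists[of V n] V Fq_subspace_iff by blast
  have Bn: "B \<subseteq> fvec n" "card B \<le> k" using B V by (auto simp: Fq_subspace_iff)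
  have zero: "x b = 0" if "(\<Sum>b\<in>B. vsc (x b) (?c b)) = 0" "b \<in> B" for x b
    using triv[OF B(3) Bn B(1) _ that(2)] that(1) by (simp add: colvec_sum_eq_0_iff)
  have inj: "inj_on ?c B"
  proof (rule inj_onI, rule ccontr)
    fix b b' assume b: "b \<in> B" "b' \<in> B" "?c b = ?c b'" "b \<noteq> b'"
    \<comment> \<open>A collision of two images would be a nontrivial relation, with coefficients
      \<open>1\<close> and \<open>- 1\<close>.\<close>
    define x :: "_ \<Rightarrow> 'f" where "x = (\<lambda>_. 0)(b := 1, b' := - 1)"
    have "(\<Sum>a\<in>B. vsc (x a) (?c a)) = (\<Sum>a\<in>{b, b'}. vsc (x a) (?c a))"
      using b B(1) by (intro sum.mono_neutral_right) (auto simp: x_def)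
    also have "\<dots> = vsc 1 (?c b) + vsc (- 1) (?c b')" using b(4) by (simp add: x_def)
    also have "\<dots> = 0" using b(3) by (simp add: fun_eq_iff)
    finally have "x b = 0" using zero b(1) by blast
    then show False using b by (simp add: x_def)
  qed
  have "vs.independent (?c ` B)"
  proof (rule vs.independent_if_scalars_zero)
    fix f x assume s: "(\<Sum>x\<in>?c ` B. vsc (f x) x) = 0" and "x \<in> ?c ` B"
    then obtain b where b: "b \<in> B" "x = ?c b" by blast
    have "(\<Sum>b\<in>B. vsc (f (?c b)) (?c b)) = 0" using s by (simp add: sum.reindex[OF inj])
    then show "f x = 0" using zero[where x="\<lambda>b. f (?c b)"] b by blast
  qed (use B in auto)
  then have "vs.dim (Gspan emb G k n V) = card (?c ` B)"
    using Gspan_eq_span_basis[OF B(2,4)] vs.dim_span_eq_card_independent by metis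
  then show "vs.dim (Gspan emb G k n V) = vs.dim V"
    using card_image[OF inj] B(5) by simp
qed

lemma colvec_sum_zero_imp:
  assumes "inj_on (colvec emb G k n) B" "vs.independent (colvec emb G k n ` B)" "finite B"
    and s: "(\<Sum>b\<in>B. vsc (x b) (colvec emb G k n b)) = 0" and b: "b \<in> B"
  shows "x b = 0"
proof -
  let ?c = "colvec emb G k n"
  let ?f = "\<lambda>y. x (the_inv_into B ?c y)"
  have "(\<Sum>y\<in>?c ` B. vsc (?f y) y) = 0"
    using s by (simp add: sum.reindex[OF assms(1)] the_inv_into_f_f[OF assms(1)])
  then have "?f (?c b) = 0"
    using vs.independentD[OF assms(2), where u="?f"] assms(3) b by blast
  then show ?thesis using b by (simp add: the_inv_into_f_f[OF assms(1)])
qed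

text \<open>Converse of \<open>rank_preservingI\<close>: the span of \<open>B\<close> keeps its
  dimension \<open>card B\<close>, so the images of \<open>B\<close> are distinct and
  independent.\<close>

lemma rank_preserving_kernel_trivial:
  assumes rp: "rank_preserving emb G k n" and B: "vs.independent B" "B \<subseteq> fvec n" "card B \<le> k"
    and s: "\<And>r. r < k \<Longrightarrow> (\<Sum>b\<in>B. x b * (\<Sum>j<n. G r j * emb (b j))) = 0" and b: "b \<in> B"
  shows "x b = 0"
proof -
  let ?c = "colvec emb G k n"
  have fin: "finite B" using finite_independent_fvec B by blast
  have "Fq_subspace n (vs.span B)" using vs.span_minimal[OF B(2) subspace_fvec] by (simp add: Fq_subspace_iff)
  moreover have "Gspan emb G k n (vs.span B) = vs.span (?c ` B)"
    by (rule Gspan_eq_span_basis[OF vs.span_superset order_refl])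
  ultimately have dim: "vs.dim (?c ` B) = card B"
    using rp B vs.dim_span_eq_card_independent[OF B(1)] unfolding rank_preserving_def
    by (metis vs.dim_span)
  have le: "card (?c ` B) \<le> card B" using fin by (rule card_image_le)
  moreover have "vs.dim (?c ` B) \<le> card (?c ` B)" using fin by (intro vs.dim_le_card') simp
  ultimately have "inj_on ?c B" using dim fin by (intro eq_card_imp_inj_on) simp_all
  moreover have "vs.independent (?c ` B)" using le dim fin by (intro vs.independent_if_card_le_dim) simp_all
  moreover have "(\<Sum>b\<in>B. vsc (x b) (?c b)) = 0"
    using s by (simp add: colvec_sum_eq_0_iff)
  ultimately show ?thesis using colvec_sum_zero_imp fin b by blast
qed

lemma rank_preserving_full_dim:
  assumes "rank_preserving emb G k n" "Fq_subspace n V" "vs.dim V = k"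
  shows "Gspan emb G k n V = fvec k"
  using assms subspace_eq_fvec[OF Gspan_fvec order_refl Gspan_subspace] dim_fvec[where ?'a='f]
  by (metis order_refl rank_preserving_def)

section \<open>Rank of a codeword and its kernel over the base field\<close>

lemma codeword_functional:
  "(\<Sum>j<n. codeword G k n u j * emb (v j)) = dot k u (colvec emb G k n v)"
  by (simp add: dot_colvec codeword_def)

lemma vector_space_emb: "vector_space (\<lambda>c x. emb c * x)"
  by unfold_locales (simp_all add: emb_add emb_mult emb_1 algebra_simps)

text \<open>Rank-nullity for the map \<open>?phi\<close> over the base field, which sends the unit
  vectors to the entries of \<open>c\<close>. It kills \<open>B\<close>, so the images of a
  complementary set \<open>C\<close> of size \<open>n - card B\<close> already span.\<close>

lemma rank_Fq_le:
  fixes c :: "nat \<Rightarrow> 'f"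
  assumes "vs.independent B" "B \<subseteq> fvec n" "\<And>b. b \<in> B \<Longrightarrow> (\<Sum>j<n. c j * emb (b j)) = 0"
  shows "rank_Fq emb n c \<le> n - card B"
proof -
  interpret e: vector_space "\<lambda>c x. emb c * x" by (rule vector_space_emb)
  let ?phi = "\<lambda>v. \<Sum>j<n. c j * emb (v j)"
  obtain C where C: "finite C" "C \<subseteq> fvec n" "fvec n \<subseteq> vs.span (B \<union> C)" "card B + card C = n"
    using fvec_basis_extend[OF assms(1,2)] by metis
  have sub: "vs.subspace {v. ?phi v \<in> e.span (?phi ` C)}"
    unfolding vs.subspace_def
  proof (intro conjI ballI allI)
    show "0 \<in> {v. ?phi v \<in> e.span (?phi ` C)}" by (simp add: emb_0 e.span_zero)
    fix v w assume v: "v \<in> {v. ?phi v \<in> e.span (?phi ` C)}"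
    { fix a
      have "?phi (vsc a v) = emb a * ?phi v"
        by (simp add: emb_mult sum_distrib_left mult.left_commute)
      then show "vsc a v \<in> {v. ?phi v \<in> e.span (?phi ` C)}" using v e.span_scale by auto }
    assume w: "w \<in> {v. ?phi v \<in> e.span (?phi ` C)}"
    have "?phi (v + w) = ?phi v + ?phi w" by (simp add: emb_add distrib_left sum.distrib)
    then show "v + w \<in> {v. ?phi v \<in> e.span (?phi ` C)}" using v w e.span_add by auto
  qed
  have "B \<union> C \<subseteq> {v. ?phi v \<in> e.span (?phi ` C)}"
    using assms(3) e.span_base e.span_zero by auto
  then have "vs.span (B \<union> C) \<subseteq> {v. ?phi v \<in> e.span (?phi ` C)}" using sub by (rule vs.span_minimal)
  then have all: "?phi v \<in> e.span (?phi ` C)" if "v \<in> fvec n" for v using C(3) that by blast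
  have "c ` {..<n} \<subseteq> e.span (?phi ` C)"
  proof
    fix y assume "y \<in> c ` {..<n}"
    then obtain i where i: "i < n" "y = c i" by auto
    have "?phi (unit_vec i) = (\<Sum>j<n. if j = i then c j else 0)"
      by (intro sum.cong) (auto simp: unit_vec_def emb_0 emb_1)
    then have "?phi (unit_vec i) = c i" using i by simp
    then show "y \<in> e.span (?phi ` C)" using all[OF unit_vec_fvec[OF i(1)]] i by simp
  qed
  then have "e.dim (c ` {..<n}) \<le> card (?phi ` C)" using C(1) by (intro e.dim_le_card) auto
  also have "\<dots> \<le> card C" using C(1) by (rule card_image_le)
  finally show ?thesis using C(4) by (simp add: rank_Fq_def)
qed

text \<open>Write the entries of \<open>c\<close> over a basis \<open>D\<close> of their span. Every
  \<open>v\<close> orthogonal to the coefficient vectors \<open>w d\<close> lies in the kernel, and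
  there are only \<open>rank_Fq emb n c\<close> many of these conditions.\<close>

lemma kernel_dim_ge:
  fixes c :: "nat \<Rightarrow> 'f"
  obtains K where "Fq_subspace n K" "n - rank_Fq emb n c \<le> vs.dim K"
    "\<And>v. v \<in> K \<Longrightarrow> (\<Sum>j<n. c j * emb (v j)) = 0"
proof -
  interpret e: vector_space "\<lambda>c x. emb c * x" by (rule vector_space_emb)
  obtain D where D: "finite D" "c ` {..<n} \<subseteq> e.span D" "card D = rank_Fq emb n c"
    unfolding rank_Fq_def using e.finite_basis_exists[OF e.span_superset, of "c ` {..<n}"]
    by (metis finite_imageI finite_lessThan)
  have "\<exists>g. c j = (\<Sum>d\<in>D. emb (g d) * d)" if "j < n" for j
    using D(2) that unfolding e.span_finite[OF D(1)] by blast
  then obtain g where g: "\<And>j. j < n \<Longrightarrow> c j = (\<Sum>d\<in>D. emb (g j d) * d)" by metis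
  define w where "w d = (\<lambda>j. if j < n then g j d else 0)" for d
  let ?K = "perp n (w ` D)"
  have w: "w ` D \<subseteq> fvec n" by (auto simp: w_def fvec_def)
  have "vs.dim (w ` D) \<le> card D"
    using vs.dim_le_card'[of "w ` D"] card_image_le[OF D(1), of w] D(1) by simp
  then have "n - rank_Fq emb n c \<le> vs.dim ?K" using dim_perp_add[OF w] D(3) by linarith
  moreover have "(\<Sum>j<n. c j * emb (v j)) = 0" if v: "v \<in> ?K" for v
  proof -
    have "(\<Sum>j<n. c j * emb (v j)) = (\<Sum>j<n. \<Sum>d\<in>D. d * emb (w d j * v j))"
      by (intro sum.cong) (simp_all add: g w_def sum_distrib_left sum_distrib_right emb_mult mult_ac)
    also have "\<dots> = (\<Sum>d\<in>D. d * emb (dot n v (w d)))"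
      by (subst sum.swap) (simp add: dot_def emb_sum sum_distrib_left mult.commute)
    also have "\<dots> = 0" using v by (simp add: perp_def emb_0)
    finally show ?thesis .
  qed
  ultimately show ?thesis using that[of ?K] by (simp add: Fq_subspace_iff subspace_perp perp_fvec)
qed

text \<open>Enlarge \<open>B\<close> to \<open>k\<close> independent vectors. If their images did
  not span \<open>fvec k\<close>, a nonzero \<open>u\<close> would be orthogonal to all of them, and
  its codeword, nonzero by \<open>G_rank\<close>, would have rank at most \<open>n - k\<close>.
  Being \<open>k\<close> in number, the spanning images are independent.\<close>

lemma rank_preserving_if_MRD:
  assumes mrd: "is_MRD emb G k n" and kn: "k \<le> n"
    and G_rank: "\<And>u. codeword G k n u = (\<lambda>_. 0) \<Longrightarrow> \<forall>i<k. u i = 0"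
  shows "rank_preserving emb G k n"
proof (rule rank_preservingI)
  fix B :: "(nat \<Rightarrow> 'q) set" and x b
  let ?c = "colvec emb G k n"
  assume B: "vs.independent B" "B \<subseteq> fvec n" "card B \<le> k" "finite B" and s: "\<And>r. r < k \<Longrightarrow> (\<Sum>b\<in>B. x b * (\<Sum>j<n. G r j * emb (b j))) = 0" "b \<in> B"
  obtain C where C: "finite C" "C \<subseteq> fvec n" "B \<inter> C = {}" "vs.independent (B \<union> C)" "card B + card C = n"
    using fvec_basis_extend[OF B(1,2)] by metis
  have "k - card B \<le> card C" using C(5) kn by simp
  then obtain C' where C': "C' \<subseteq> C" "card C' = k - card B"
    using obtain_subset_with_card_n by metis
  let ?B = "B \<union> C'"
  have fin: "finite ?B" using B(4) C' C(1) finite_subset by blast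
  have B': "vs.independent ?B" "?B \<subseteq> fvec n" "card ?B = k"
  proof -
    show "vs.independent ?B" by (rule vs.independent_mono[OF C(4)]) (use C' in blast)
    show "?B \<subseteq> fvec n" using B C C' by blast
    have "card ?B = card B + card C'"
      using B(4) fin C(3) C'(1) by (intro card_Un_disjoint) auto
    then show "card ?B = k" using B(3) C'(2) by simp
  qed
  have "perp k (?c ` ?B) \<subseteq> {0}"
  proof
    fix u assume u: "u \<in> perp k (?c ` ?B)"
    show "u \<in> {0}"
    proof (rule ccontr)
      assume "u \<notin> {0}"
      then obtain i where "u i \<noteq> 0" by (auto simp: fun_eq_iff)
      moreover from this have "i < k" using u unfolding fvec_def perp_def by (metis (mono_tags, lifting) mem_Collect_eq not_le)
      ultimately have "codeword G k n u \<noteq> (\<lambda>_. 0)" using G_rank by blast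
      then have "n - k + 1 \<le> rank_Fq emb n (codeword G k n u)" using mrd is_MRD_def by blast
      also have "\<dots> \<le> n - card ?B"
        using u by (intro rank_Fq_le B') (auto simp: codeword_functional perp_def)
      finally show False using B'(3) by simp
    qed
  qed
  then have "vs.dim (perp k (?c ` ?B)) \<le> 0"
    using vs.dim_le_card[of "perp k (?c ` ?B)" "{}"] by simp
  moreover have "?c ` ?B \<subseteq> fvec k" using colvec_fvec by blast
  ultimately have dimk: "vs.dim (?c ` ?B) = k" using dim_perp_add[of "?c ` ?B" k] by simp
  have le: "card (?c ` ?B) \<le> card ?B" using fin by (rule card_image_le)
  have ge: "vs.dim (?c ` ?B) \<le> card (?c ` ?B)" using fin by (intro vs.dim_le_card') simp
  have "card (?c ` ?B) = card ?B" using le ge dimk B'(3) by simp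
  then have inj: "inj_on ?c ?B" using fin eq_card_imp_inj_on by blast
  have ind: "vs.independent (?c ` ?B)"
    using fin le dimk B'(3) by (intro vs.independent_if_card_le_dim) auto
  show "x b = 0"
  proof (rule colvec_sum_zero_imp[OF _ _ B(4) _ s(2)])
    show "(\<Sum>b\<in>B. vsc (x b) (?c b)) = 0"
      using s(1) by (simp add: colvec_sum_eq_0_iff)
    show "inj_on ?c B" by (rule inj_on_subset[OF inj]) blast
    show "vs.independent (?c ` B)" by (rule vs.independent_mono[OF ind]) blast
  qed
qed

text \<open>A nonzero codeword of too small rank is killed by a subspace of dimension
  \<open>k\<close> over the base field. The column span of that subspace is all of
  \<open>fvec k\<close>, so \<open>u\<close> vanishes on its first \<open>k\<close>
  coordinates.\<close>

lemma MRD_if_rank_preserving: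
  assumes rp: "rank_preserving emb G k n" and kn: "k \<le> n"
  shows "is_MRD emb G k n"
  unfolding is_MRD_def
proof (intro allI impI, rule ccontr)
  fix u assume nz: "codeword G k n u \<noteq> (\<lambda>_. 0)" and "\<not> n - k + 1 \<le> rank_Fq emb n (codeword G k n u)"
  then have rank: "k \<le> n - rank_Fq emb n (codeword G k n u)" using kn by simp
  obtain K where K: "Fq_subspace n K" "n - rank_Fq emb n (codeword G k n u) \<le> vs.dim K"
    "\<And>v. v \<in> K \<Longrightarrow> (\<Sum>j<n. codeword G k n u j * emb (v j)) = 0"
    using kernel_dim_ge[of n "codeword G k n u"] by blast
  have Kn: "vs.subspace K" "K \<subseteq> fvec n" using K(1) Fq_subspace_iff by auto
  obtain B where B: "finite B" "B \<subseteq> K" "vs.independent B" "K \<subseteq> vs.span B" "card B = vs.dim K"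
    using fvec_basis_exists[OF Kn(2)] .
  obtain B' where B': "B' \<subseteq> B" "card B' = k"
    using obtain_subset_with_card_n[of k B] rank K(2) B(5) by auto
  have "vs.span B' \<subseteq> K" using B' B(2) Kn(1) by (intro vs.span_minimal) auto
  then have V: "Fq_subspace n (vs.span B')" "vs.span B' \<subseteq> K"
    using Kn(2) by (auto simp: Fq_subspace_iff)
  have "vs.dim (vs.span B') = k"
    using vs.dim_span_eq_card_independent vs.independent_mono[OF B(3) B'(1)] B'(2) by metis
  then have full: "Gspan emb G k n (vs.span B') = fvec k" using rank_preserving_full_dim rp V by blast
  have "u i = 0" if "i < k" for i
  proof -
    have "dot k u (unit_vec i) = 0"
    proof (rule dot_Gspan_zero)
      show "unit_vec i \<in> Gspan emb G k n (vs.span B')" using full unit_vec_fvec[OF that] by simp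
      fix v assume "v \<in> vs.span B'"
      then show "dot k u (colvec emb G k n v) = 0" using K(3)[of v] V(2) codeword_functional by auto
    qed
    then show ?thesis using dot_unit_vec_right[OF that] by metis
  qed
  then have "codeword G k n u = (\<lambda>_. 0)" by (auto simp: codeword_def fun_eq_iff)
  then show False using nz by blast
qed

end

section \<open>The generic matrix attains every generic kernel pattern\<close>

interpretation constK_field: field_hom "constK :: 'q::field \<Rightarrow> 'q ratfun" ..

text \<open>Adapts \<open>generic_kernel_trivial\<close> to systems in which each equation involves
  a single row of the matrix; the array \<open>a\<close> puts zero coefficients on all other
  rows.\<close>

corollary generic_rows_kernel_trivial:
  fixes f :: "'r \<Rightarrow> 'b \<Rightarrow> nat \<Rightarrow> 'q::field" and U :: "nat \<Rightarrow> nat \<Rightarrow> 'q ratfun" and row :: "'r \<Rightarrow> nat"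
  assumes fin: "finite B" and row: "\<And>r. r \<in> R \<Longrightarrow> row r < k"
    and triv: "\<And>x b. (\<And>r. r \<in> R \<Longrightarrow> (\<Sum>b\<in>B. x b * (\<Sum>j<n. constK (f r b j) * U (row r) j)) = 0) \<Longrightarrow> b \<in> B \<Longrightarrow> x b = 0"
    and eq: "\<And>r. r \<in> R \<Longrightarrow> (\<Sum>b\<in>B. x b * (\<Sum>j<n. constK (f r b j) * Zmat (row r) j)) = 0"
    and b: "b \<in> B"
  shows "x b = 0"
proof -
  define a where "a r b s = (if fst s = row r then f r b (snd s) else 0)" for r b and s :: "nat \<times> nat"
  have rows: "(\<Sum>s\<in>{..<k} \<times> {..<n}. constK (a r b s) * X (fst s) (snd s)) = (\<Sum>j<n. constK (f r b j) * X (row r) j)"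
    if "r \<in> R" for r b and X :: "nat \<Rightarrow> nat \<Rightarrow> 'q ratfun"
  proof -
    have "(\<Sum>s\<in>{..<k} \<times> {..<n}. constK (a r b s) * X (fst s) (snd s)) =
        (\<Sum>i<k. \<Sum>j<n. constK (a r b (i, j)) * X i j)"
      by (simp add: sum.cartesian_product')
    also have "\<dots> = (\<Sum>i<k. if i = row r then \<Sum>j<n. constK (f r b j) * X (row r) j else 0)"
      by (intro sum.cong) (auto simp: a_def constK.emb_0)
    finally show ?thesis using row[OF that] by simp
  qed
  show ?thesis
  proof (rule generic_kernel_trivial[where B=B and R=R and P="{..<k} \<times> {..<n}" and a=a and U="\<lambda>s. U (fst s) (snd s)"])
    fix x b assume *: "\<And>r. r \<in> R \<Longrightarrow> (\<Sum>b\<in>B. x b * (\<Sum>s\<in>{..<k} \<times> {..<n}. constK (a r b s) * U (fst s) (snd s))) = 0"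
      and "b \<in> B"
    have "(\<Sum>b\<in>B. x b * (\<Sum>j<n. constK (f r b j) * U (row r) j)) = 0" if "r \<in> R" for r
      using *[OF that] by (simp only: rows[OF that])
    then show "x b = 0" using \<open>b \<in> B\<close> by (rule triv)
  next
    fix r assume "r \<in> R"
    then show "(\<Sum>b\<in>B. x b * (\<Sum>s\<in>{..<k} \<times> {..<n}. constK (a r b s) * Zmat (fst s) (snd s))) = 0"
      using eq by (simp only: rows)
  qed (use fin b in auto)
qed

text \<open>The first \<open>k\<close> rows are injective on \<open>W\<close>, because the remaining ones vanish there.\<close>

lemma pattern_matrix_injective_on:
  assumes gkp: "is_GKP k n V" and kn: "k \<le> n" and W: "Fq_subspace n W" "vs.dim W \<le> k"
  obtains M N where "inverse_mats n M N" "\<And>i. i < k \<Longrightarrow> M i \<in> perp n (V i)"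
    "\<And>i. k \<le> i \<Longrightarrow> i < n \<Longrightarrow> M i \<in> perp n W"
proof -
  define S where "S i = (if i < k then V i else W)" for i
  have V: "\<And>i. i < k \<Longrightarrow> Fq_subspace n (V i)" using gkp by (simp add: is_GKP_def)
  have S: "Fq_subspace n (S i)" if "i < n" for i using V W by (simp add: S_def)
  have dim: "vs.dim (\<Inter>i\<in>J. S i) \<le> n - card J" if J: "J \<noteq> {}" "J \<subseteq> {..<n}" for J
  proof -
    \<comment> \<open>\<open>?J1\<close> collects pattern rows and \<open>?J2\<close> complementary
      rows, of which there are at most \<open>n - k\<close>. If \<open>?J1\<close> is empty,
      \<open>vs.dim W \<le> k\<close> suffices; otherwise the GKP bound for \<open>?J1\<close>
      does.\<close>
    let ?J1 = "J \<inter> {..<k}" and ?J2 = "J - {..<k}"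
    have fin: "finite J" using J finite_subset by blast
    have c: "card J = card ?J1 + card ?J2"
      using card_Int_Diff[OF fin] by blast
    have c2: "card ?J2 \<le> n - k"
    proof -
      have "?J2 \<subseteq> {k..<n}" using J by auto
      then show ?thesis using card_mono[of "{k..<n}" ?J2] by simp
    qed
    show ?thesis
    proof (cases "?J1 = {}")
      case True
      then obtain i where i: "i \<in> J" "\<not> i < k" using J by auto
      then have sub: "(\<Inter>i\<in>J. S i) \<subseteq> W" by (auto simp: S_def)
      have "vs.dim (\<Inter>i\<in>J. S i) \<le> vs.dim W"
        using dim_subset_fvec[OF sub] W(1) Fq_subspace_iff by blast
      moreover have "card ?J1 = 0" by (simp only: True card.empty)
      ultimately show ?thesis using W(2) c c2 kn by linarith
    next
      case False
      then obtain i where i: "i \<in> ?J1" by blast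
      have sub: "(\<Inter>i\<in>J. S i) \<subseteq> (\<Inter>i\<in>?J1. V i)" by (auto simp: S_def split: if_splits)
      have "(\<Inter>i\<in>?J1. V i) \<subseteq> fvec n" using i V Fq_subspace_iff by blast
      then have "vs.dim (\<Inter>i\<in>J. S i) \<le> vs.dim (\<Inter>i\<in>?J1. V i)" by (rule dim_subset_fvec[OF sub])
      also have "\<dots> \<le> k - card ?J1" using gkp False by (rule is_GKP_dim_Inter_le) simp
      also have "\<dots> \<le> n - card J" using c c2 kn by linarith
      finally show ?thesis .
    qed
  qed
  have sub: "\<And>i. i < n \<Longrightarrow> vs.subspace (S i)" "\<And>i. i < n \<Longrightarrow> S i \<subseteq> fvec n"
    using S unfolding Fq_subspace_iff by simp_all
  obtain M N where MN: "inverse_mats n M N" "\<And>i. i < n \<Longrightarrow> M i \<in> perp n (S i)"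
    using transversal_of_perps[OF sub dim] by blast
  show ?thesis
  proof (rule that[OF MN(1)])
    show "M i \<in> perp n (V i)" if "i < k" for i using MN(2)[of i] that kn by (simp add: S_def)
    show "M i \<in> perp n W" if "k \<le> i" "i < n" for i using MN(2)[of i] that by (simp add: S_def)
  qed
qed

text \<open>Applying \<open>N\<close> undoes \<open>M\<close> and turns the equations into a
  relation between the vectors of \<open>B\<close> themselves. These stay independent over
  \<open>K\<close>: a functional \<open>u\<close> over the base field, dual to \<open>b\<close>,
  isolates \<open>x b\<close>.\<close>

lemma base_field_kernel_trivial:
  fixes B :: "(nat \<Rightarrow> 'q::field) set" and x :: "(nat \<Rightarrow> 'q) \<Rightarrow> 'q ratfun"
  assumes B: "vs.independent B" "B \<subseteq> fvec n" "finite B"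
    and M: "inverse_mats n M N"
    and eq: "\<And>i. i < n \<Longrightarrow> (\<Sum>b\<in>B. x b * constK (dot n (M i) b)) = 0"
    and b: "b \<in> B"
  shows "x b = 0"
proof -
  have coord: "(\<Sum>b\<in>B. x b * constK (b j)) = 0" if "j < n" for j
  proof -
    have "(\<Sum>b\<in>B. x b * constK (b j)) = (\<Sum>b\<in>B. \<Sum>i<n. constK (N j i) * (x b * constK (dot n (M i) b)))"
    proof (rule sum.cong[OF refl])
      fix b
      have "constK (b j) = (\<Sum>i<n. constK (N j i) * constK (dot n (M i) b))"
        by (subst inverse_mats_expand[OF M that, of b]) (simp add: constK.emb_sum constK.emb_mult)
      then show "x b * constK (b j) = (\<Sum>i<n. constK (N j i) * (x b * constK (dot n (M i) b)))"
        by (simp add: sum_distrib_left mult.left_commute)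
    qed
    also have "\<dots> = (\<Sum>i<n. constK (N j i) * (\<Sum>b\<in>B. x b * constK (dot n (M i) b)))"
      by (subst sum.swap) (simp add: sum_distrib_left)
    also have "\<dots> = 0" using eq by simp
    finally show ?thesis .
  qed
  obtain u where u: "\<And>c. c \<in> B \<Longrightarrow> dot n u c = (if c = b then 1 else 0)"
    using dot_extend[OF B(1,2), where f="\<lambda>c. if c = b then 1 else 0"] by blast
  have "(\<Sum>c\<in>B. x c * constK (dot n u c)) = (\<Sum>c\<in>B. if c = b then x c else 0)"
    using u by (intro sum.cong) (auto simp: constK.emb_0 constK.emb_1)
  then have "x b = (\<Sum>c\<in>B. x c * constK (dot n u c))" using B(3) b by simp
  also have "\<dots> = (\<Sum>c\<in>B. \<Sum>j<n. constK (u j) * (x c * constK (c j)))"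
    by (simp add: dot_def constK.emb_sum constK.emb_mult sum_distrib_left mult.left_commute)
  also have "\<dots> = (\<Sum>j<n. constK (u j) * (\<Sum>c\<in>B. x c * constK (c j)))"
    by (subst sum.swap) (simp add: sum_distrib_left)
  also have "\<dots> = 0" using coord by simp
  finally show ?thesis .
qed

text \<open>Row \<open>i\<close> of \<open>U\<close> is the combination of a spanning family of \<open>(V i)\<^sup>\<bottom>\<close> with coefficients \<open>Z\<^bsub>i,s\<^esub>\<close>.\<close>

lemma generic_pattern_matrix:
  fixes V :: "nat \<Rightarrow> (nat \<Rightarrow> 'q::field) set"
  assumes gkp: "is_GKP k n V" and kn: "k \<le> n"
  obtains U :: "nat \<Rightarrow> nat \<Rightarrow> 'q ratfun"
  where "\<And>i v. i < k \<Longrightarrow> v \<in> V i \<Longrightarrow> (\<Sum>j<n. constK (v j) * U i j) = 0"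
    "rank_preserving constK U k n"
proof -
  have "\<exists>P. (\<forall>s<n. P s \<in> perp n (V i)) \<and> perp n (V i) \<subseteq> vs.span (P ` {..<n})" for i
  proof -
    obtain B where B: "finite B" "B \<subseteq> perp n (V i)" "vs.independent B" "perp n (V i) \<subseteq> vs.span B" "card B = vs.dim (perp n (V i))"
      using fvec_basis_exists[OF perp_fvec] .
    obtain h where h: "bij_betw h {..<card B} B"
      using ex_bij_betw_nat_finite[OF B(1)] atLeast0LessThan by metis
    \<comment> \<open>Padding with zeros gives every complement a spanning family of the same length
      \<open>n\<close>.\<close>
    define P where "P s = (if s < card B then h s else 0)" for s
    have le: "card B \<le> n" using B(5) dim_le_fvec[OF perp_fvec, of n "V i"] by simp
    have "B \<subseteq> P ` {..<n}"
    proof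
      fix b assume "b \<in> B"
      then obtain s where "s < card B" "b = h s" using h by (auto simp: bij_betw_def)
      then show "b \<in> P ` {..<n}" using le by (auto simp: P_def intro!: image_eqI[of _ _ s])
    qed
    then have "perp n (V i) \<subseteq> vs.span (P ` {..<n})" using B(4) vs.span_mono by blast
    moreover have "P s \<in> perp n (V i)" for s
      using h B(2) vs.subspace_0[OF subspace_perp] by (auto simp: P_def bij_betw_def)
    ultimately show ?thesis by blast
  qed
  then obtain P where P: "\<And>i s. s < n \<Longrightarrow> P i s \<in> perp n (V i)" "\<And>i. perp n (V i) \<subseteq> vs.span (P i ` {..<n})"
    by metis
  define U :: "nat \<Rightarrow> nat \<Rightarrow> 'q ratfun" where "U i j = (\<Sum>s<n. Zmat i s * constK (P i s j))" for i j
  \<comment> \<open>Swapping the sums makes equations on \<open>U\<close> linear in the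
    \<open>Zmat i s\<close>, with coefficients from the base field, so that specialisation applies
    to them.\<close>
  have comb: "(\<Sum>j<n. constK (v j) * (\<Sum>s<n. X s * constK (P i s j))) = (\<Sum>s<n. constK (dot n (P i s) v) * X s)"
    for v i and X :: "nat \<Rightarrow> 'q ratfun"
  proof -
    have "(\<Sum>j<n. constK (v j) * (\<Sum>s<n. X s * constK (P i s j))) =
        (\<Sum>j<n. \<Sum>s<n. constK (P i s j * v j) * X s)"
      by (simp add: sum_distrib_left constK.emb_mult mult_ac)
    also have "\<dots> = (\<Sum>s<n. constK (dot n (P i s) v) * X s)"
      by (subst sum.swap) (simp add: dot_def constK.emb_sum sum_distrib_right)
    finally show ?thesis .
  qed
  show ?thesis
  proof (rule that)
    fix i v assume "i < k" "v \<in> V i"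
    then have "dot n (P i s) v = 0" if "s < n" for s using P(1)[OF that, of i] by (auto simp: perp_def)
    then show "(\<Sum>j<n. constK (v j) * U i j) = 0" unfolding U_def comb by (simp add: constK.emb_0)
  next
    show "rank_preserving constK U k n"
    proof (rule constK_field.rank_preservingI)
      fix B :: "(nat \<Rightarrow> 'q) set" and x b
      assume B: "vs.independent B" "B \<subseteq> fvec n" "card B \<le> k" "finite B"
        and eq: "\<And>r. r < k \<Longrightarrow> (\<Sum>b\<in>B. x b * (\<Sum>j<n. U r j * constK (b j))) = 0" and b: "b \<in> B"
      have W: "Fq_subspace n (vs.span B)" "vs.dim (vs.span B) \<le> k"
        using vs.span_minimal[OF B(2) subspace_fvec] vs.dim_span_eq_card_independent[OF B(1)] B(3)
        by (auto simp: Fq_subspace_iff)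
      obtain M N where MN: "inverse_mats n M N" "\<And>i. i < k \<Longrightarrow> M i \<in> perp n (V i)"
        "\<And>i. k \<le> i \<Longrightarrow> i < n \<Longrightarrow> M i \<in> perp n (vs.span B)"
        using pattern_matrix_injective_on[OF gkp kn W] by metis
      have "\<exists>z. M i = (\<Sum>s<n. vsc (z s) (P i s))" if i: "i < k" for i
      proof -
        have "M i \<in> vs.span (P i ` {..<n})" using MN(2)[OF i] P(2) by blast
        then show ?thesis by (intro vs.span_image_imp_sum) auto
      qed
      then obtain z where z: "\<And>i. i < k \<Longrightarrow> M i = (\<Sum>s<n. vsc (z i s) (P i s))" by metis
      \<comment> \<open>Specialising \<open>Zmat i s\<close> to \<open>constK (z i s)\<close> turns
        row \<open>i\<close> of \<open>U\<close> into \<open>M i\<close>, a row over the base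
        field.\<close>
      show "x b = 0"
      proof (rule generic_rows_kernel_trivial[where B=B and R="{..<k}" and row="\<lambda>r. r" and n=n and k=k
            and f="\<lambda>r b s. dot n (P r s) b" and U="\<lambda>i s. constK (z i s)"])
        fix r assume r: "r \<in> {..<k}"
        have "(\<Sum>j<n. U r j * constK (b j)) = (\<Sum>j<n. constK (dot n (P r j) b) * Zmat r j)" for b
          unfolding comb[symmetric] U_def by (intro sum.cong refl mult.commute)
        then show "(\<Sum>b\<in>B. x b * (\<Sum>j<n. constK (dot n (P r j) b) * Zmat r j)) = 0"
          using eq[of r] r by simp
      next
        fix x :: "(nat \<Rightarrow> 'q) \<Rightarrow> 'q ratfun" and b
        assume *: "\<And>r. r \<in> {..<k} \<Longrightarrow> (\<Sum>b\<in>B. x b * (\<Sum>j<n. constK (dot n (P r j) b) * constK (z r j))) = 0"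
          and b: "b \<in> B"
        show "x b = 0"
        proof (rule base_field_kernel_trivial[OF B(1,2,4) MN(1) _ b])
          fix i assume "i < n"
          show "(\<Sum>b\<in>B. x b * constK (dot n (M i) b)) = 0"
          proof (cases "i < k")
            case True
            have "constK (dot n (M i) b) = (\<Sum>j<n. constK (dot n (P i j) b) * constK (z i j))" for b
              by (simp add: z[OF True] dot_sum_left dot_vsc_left constK.emb_sum constK.emb_mult mult.commute)
            then show ?thesis using *[of i] True by simp
          next
            case False
            then have "dot n (M i) b = 0" if "b \<in> B" for b
              using MN(3)[of i] \<open>i < n\<close> vs.span_base[OF that] by (auto simp: perp_def)
            then show ?thesis by (simp add: constK.emb_0)
          qed
        qed
      qed (use B b in auto)
    qed
  qed
qed

text \<open>By specialisation one rank-preserving matrix over \<open>K\<close> is enough, and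
  \<open>generic_pattern_matrix\<close> for the zero pattern supplies it.\<close>

lemma rank_preserving_Zmat:
  assumes kn: "k \<le> n"
  shows "rank_preserving (constK :: 'q::field \<Rightarrow> _) Zmat k n"
proof (rule constK_field.rank_preservingI)
  fix B :: "(nat \<Rightarrow> 'q) set" and x b
  assume B: "vs.independent B" "B \<subseteq> fvec n" "card B \<le> k" "finite B"
    and eq: "\<And>r. r < k \<Longrightarrow> (\<Sum>b\<in>B. x b * (\<Sum>j<n. Zmat r j * constK (b j))) = 0" and b: "b \<in> B"
  have gkp: "is_GKP k n (\<lambda>_. {0 :: nat \<Rightarrow> 'q})"
    by (auto simp: is_GKP_def Fq_subspace_iff fvec_def dim_zero_space)
  obtain U :: "nat \<Rightarrow> nat \<Rightarrow> 'q ratfun" where U: "rank_preserving constK U k n"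
    using generic_pattern_matrix[OF gkp kn] by metis
  show "x b = 0"
  proof (rule generic_rows_kernel_trivial[where B=B and R="{..<k}" and row="\<lambda>r. r" and n=n and k=k
          and f="\<lambda>r b. b" and U=U])
    fix r assume "r \<in> {..<k}"
    then show "(\<Sum>b\<in>B. x b * (\<Sum>j<n. constK (b j) * Zmat r j)) = 0"
      using eq[of r] by (simp add: mult.commute[of "Zmat _ _"])
  next
    fix x :: "(nat \<Rightarrow> 'q) \<Rightarrow> 'q ratfun" and b
    assume *: "\<And>r. r \<in> {..<k} \<Longrightarrow> (\<Sum>b\<in>B. x b * (\<Sum>j<n. constK (b j) * U r j)) = 0" and "b \<in> B"
    then show "x b = 0"
      by (elim constK_field.rank_preserving_kernel_trivial[OF U B(1-3), rotated]) (simp add: mult.commute[of "U _ _"])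
  qed (use B b in auto)
qed

text \<open>The linear system with trivial kernel says, for \<open>i \<in> J\<close> and \<open>r < k\<close>, that coordinate \<open>r\<close> of a
  combination of columns from \<open>V i\<close> vanishes if \<open>r \<notin> J\<close> and agrees with that of a combination from
  \<open>V r\<close> if \<open>r \<in> J\<close>. At \<open>U\<close> the latter is \<open>0\<close>, because row \<open>r\<close> of \<open>U\<close> annihilates \<open>V r\<close>.\<close>

lemma dim_Inter_Gspan_Zmat_le:
  fixes V :: "nat \<Rightarrow> (nat \<Rightarrow> 'q::field) set"
  assumes gkp: "is_GKP k n V" and kn: "k \<le> n" and J: "J \<noteq> {}" "J \<subseteq> {..<k}"
  shows "vs.dim (\<Inter>i\<in>J. Gspan constK (Zmat :: nat \<Rightarrow> nat \<Rightarrow> 'q ratfun) k n (V i)) \<le> k - card J"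
proof (rule dim_le_if_coordinates_detect[OF _ _ J(2)])
  let ?W = "\<lambda>V. Gspan constK (Zmat :: nat \<Rightarrow> nat \<Rightarrow> 'q ratfun) k n V"
  show "vs.subspace (\<Inter>i\<in>J. ?W (V i))" by (intro vs.subspace_Int Gspan_subspace)
  show "(\<Inter>i\<in>J. ?W (V i)) \<subseteq> fvec k"
  proof -
    obtain i where "i \<in> J" using J(1) by auto
    then have "(\<Inter>i\<in>J. ?W (V i)) \<subseteq> ?W (V i)" by (rule INF_lower)
    then show ?thesis using Gspan_fvec by (rule order_trans)
  qed
  fix y assume y: "y \<in> (\<Inter>i\<in>J. ?W (V i))" and y0: "\<And>r. r < k \<Longrightarrow> r \<notin> J \<Longrightarrow> y r = 0"
  let ?Q = "\<lambda>i B. finite B \<and> B \<subseteq> V i \<and> vs.independent B \<and> V i \<subseteq> vs.span B \<and> B \<subseteq> fvec n \<and> card B \<le> k"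
  have "\<forall>i\<in>J. \<exists>B. ?Q i B"
  proof
    fix i assume "i \<in> J"
    then have i: "i < k" using J by blast
    then have Vi: "V i \<subseteq> fvec n" using gkp by (auto simp: is_GKP_def Fq_subspace_iff)
    obtain B where B: "finite B" "B \<subseteq> V i" "vs.independent B" "V i \<subseteq> vs.span B" "card B = vs.dim (V i)"
      using fvec_basis_exists[OF Vi] .
    then show "\<exists>B. ?Q i B" using Vi is_GKP_dim_le[OF gkp i] by (intro exI[of _ B] conjI) auto
  qed
  then obtain B where "\<forall>i\<in>J. ?Q i (B i)" using bchoice[of J ?Q] by auto
  then have B: "\<And>i. i \<in> J \<Longrightarrow> finite (B i)" "\<And>i. i \<in> J \<Longrightarrow> B i \<subseteq> V i"
    "\<And>i. i \<in> J \<Longrightarrow> vs.independent (B i)" "\<And>i. i \<in> J \<Longrightarrow> V i \<subseteq> vs.span (B i)"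
    "\<And>i. i \<in> J \<Longrightarrow> B i \<subseteq> fvec n" "\<And>i. i \<in> J \<Longrightarrow> card (B i) \<le> k"
    by simp_all
  have fJ: "finite J" using J finite_subset by blast
  have "\<exists>x. y = (\<Sum>b\<in>B i. vsc (x b) (colvec constK Zmat k n b))" if i: "i \<in> J" for i
  proof -
    have "y \<in> vs.span (colvec constK Zmat k n ` B i)"
      using y i constK_field.Gspan_subset_span[OF B(4)[OF i]] by blast
    then show ?thesis using B(1)[OF i] by (intro vs.span_image_imp_sum)
  qed
  then obtain x where x: "\<And>i. i \<in> J \<Longrightarrow> y = (\<Sum>b\<in>B i. vsc (x i b) (colvec constK Zmat k n b))" by metis
  obtain U :: "nat \<Rightarrow> nat \<Rightarrow> 'q ratfun" where U0: "\<And>i v. i < k \<Longrightarrow> v \<in> V i \<Longrightarrow> (\<Sum>j<n. constK (v j) * U i j) = 0"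
    and U: "rank_preserving constK U k n"
    using generic_pattern_matrix[OF gkp kn] by blast
  define c :: "nat \<times> nat \<Rightarrow> nat \<Rightarrow> 'q" where
    "c ri i' = (if i' = snd ri then 1 else 0) - (if fst ri \<in> J \<and> i' = fst ri then 1 else 0)" for ri i'
  define F where "F X x i r = (\<Sum>b\<in>B i. x (i, b) * (\<Sum>j<n. constK (b j) * X r j))"
    for X :: "nat \<Rightarrow> nat \<Rightarrow> 'q ratfun" and x :: "nat \<times> (nat \<Rightarrow> 'q) \<Rightarrow> 'q ratfun" and i r
  have system: "(\<Sum>p\<in>Sigma J B. x p * (\<Sum>j<n. constK (c (r, i) (fst p) * snd p j) * X r j)) =
      F X x i r - (if r \<in> J then F X x r r else 0)" if "i \<in> J"
    for X :: "nat \<Rightarrow> nat \<Rightarrow> 'q ratfun" and x i r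
  proof -
    have cK: "constK (c (r, i) i') = (if i' = i then 1 else 0) - (if r \<in> J \<and> i' = r then 1 else 0)" for i'
      by (simp add: c_def constK.emb_diff constK.emb_0 constK.emb_1)
    have "(\<Sum>p\<in>Sigma J B. x p * (\<Sum>j<n. constK (c (r, i) (fst p) * snd p j) * X r j)) =
        (\<Sum>i'\<in>J. \<Sum>b\<in>B i'. x (i', b) * (\<Sum>j<n. constK (c (r, i) i' * b j) * X r j))"
      using fJ B(1) by (subst sum.Sigma) (auto simp: case_prod_beta)
    also have "\<dots> = (\<Sum>i'\<in>J. constK (c (r, i) i') * F X x i' r)"
      by (simp add: F_def constK.emb_mult sum_distrib_left mult_ac)
    also have "\<dots> = (\<Sum>i'\<in>J. (if i' = i then F X x i' r else 0) - (if i' = r then if r \<in> J then F X x i' r else 0 else 0))"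
      by (intro sum.cong) (auto simp: cK)
    also have "\<dots> = F X x i r - (if r \<in> J then F X x r r else 0)"
      using fJ that by (simp add: sum_subtractf)
    finally show ?thesis .
  qed
  \<comment> \<open>The unknowns are indexed by the disjoint union of the bases, since a vector may
    occur in several of them.\<close>
  have "(\<lambda>(i, b). x i b) p = 0" if p: "p \<in> Sigma J B" for p
  proof (rule generic_rows_kernel_trivial[where B="Sigma J B" and R="{..<k} \<times> J" and row=fst and k=k and n=n
        and f="\<lambda>ri p j. c ri (fst p) * snd p j" and U=U])
    show "finite (Sigma J B)" using fJ B(1) by blast
    fix r assume r: "r \<in> {..<k} \<times> J"
    show "fst r < k" using r by auto
    \<comment> \<open>At \<open>Zmat\<close> all blocks expand the same vector \<open>y\<close>, so
      their differences vanish; coordinates outside \<open>J\<close> vanish by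
      \<open>y0\<close>.\<close>
    have "F Zmat (\<lambda>(i, b). x i b) i (fst r) = y (fst r)" if "i \<in> J" for i
      using arg_cong[OF x[OF that], of "\<lambda>f. f (fst r)"] r
      by (auto simp: F_def sum_fun_apply colvec_def mult.commute)
    then show "(\<Sum>p\<in>Sigma J B. (case p of (i, b) \<Rightarrow> x i b) * (\<Sum>j<n. constK (c r (fst p) * snd p j) * Zmat (fst r) j)) = 0"
      using system[of "snd r" "\<lambda>(i, b). x i b" "fst r" Zmat] r y0[of "fst r"] by auto
  next
    fix x :: "nat \<times> (nat \<Rightarrow> 'q) \<Rightarrow> 'q ratfun" and p
    assume *: "\<And>r. r \<in> {..<k} \<times> J \<Longrightarrow> (\<Sum>p\<in>Sigma J B. x p * (\<Sum>j<n. constK (c r (fst p) * snd p j) * U (fst r) j)) = 0"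
      and p: "p \<in> Sigma J B"
    obtain i b where ib: "p = (i, b)" "i \<in> J" "b \<in> B i" using p by auto
    have "F U x i r = 0" if r: "r < k" for r
    proof -
      \<comment> \<open>The equation with index \<open>(r, r)\<close> is void for
        \<open>r \<in> J\<close>, so this value has to come from \<open>U0\<close>.\<close>
      have "F U x r r = 0" if "r \<in> J"
        unfolding F_def using B(2)[OF that] U0[OF r] by (intro sum.neutral) auto
      then show ?thesis using system[OF ib(2), of x r U] *[of "(r, i)"] r ib(2) by auto
    qed
    then have "x (i, b) = 0"
      using constK_field.rank_preserving_kernel_trivial[OF U B(3,5,6)[OF ib(2)], of "\<lambda>b. x (i, b)" b] ib(3)
      by (simp add: F_def mult.commute[of "U _ _"])
    then show "x p = 0" using ib by simp
  qed (rule that)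
  then have x0: "x i b = 0" if "i \<in> J" "b \<in> B i" for i b using that by force
  obtain i where "i \<in> J" using J(1) by blast
  then have "y = (\<Sum>b\<in>B i. vsc 0 (colvec constK Zmat k n b))"
    using x x0 by (metis (no_types, lifting) sum.cong)
  then show "y = 0" by (simp add: fun_eq_iff sum_fun_apply)
qed

lemma attains_Zmat:
  assumes "is_GKP k n V" "k \<le> n"
  shows "attains constK Zmat k n V"
  using assms by (intro attains_if_dim_Inter_le dim_Inter_Gspan_Zmat_le)

text \<open>MRD(l) speaks of exactly \<open>l\<close> subspaces. A shorter list is filled up by
  repeating its first member, which leaves the intersection unchanged.\<close>

lemma finite_set_enumeration:
  assumes "finite A" "A \<noteq> {}" "card A \<le> l"
  obtains f :: "nat \<Rightarrow> 'a" where "f ` {..<l} = A"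
proof -
  obtain h where h: "bij_betw h {..<card A} A"
    using ex_bij_betw_nat_finite[OF assms(1)] atLeast0LessThan by metis
  have "0 < card A" using assms by (simp add: card_gt_0_iff)
  define f where "f i = (if i < card A then h i else h 0)" for i
  have "f ` {..<card A} = A" using h by (simp add: f_def bij_betw_def)
  moreover have "f i \<in> A" for i using h \<open>0 < card A\<close> by (auto simp: f_def bij_betw_def)
  ultimately have "f ` {..<l} = A" using assms(3) by fastforce
  then show ?thesis using that by blast
qed

theorem mainTheorem4:
  fixes emb :: "'q::{finite,field} \<Rightarrow> 'f::field"
    and G :: "nat \<Rightarrow> nat \<Rightarrow> 'f"
    and k n l :: nat
  assumes emb_1: "emb 1 = 1"
    and emb_add: "\<And>a b. emb (a + b) = emb a + emb b"
    and emb_mult: "\<And>a b. emb (a * b) = emb a * emb b"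
    and G_rank: "\<And>u. codeword G k n u = (\<lambda>_. 0) \<Longrightarrow> \<forall>i<k. u i = 0"
    and "1 \<le> k" and "k \<le> n" and "1 \<le> l"
  shows "is_GKP_code emb G k n l \<longleftrightarrow> is_MRD_l emb G k n l"
proof -
  interpret field_hom emb by unfold_locales (fact emb_1 emb_add emb_mult)+
  let ?W = "Gspan constK (Zmat :: nat \<Rightarrow> nat \<Rightarrow> 'q ratfun) k n"
  note kn = \<open>k \<le> n\<close>
  note rpZ = rank_preserving_Zmat[OF kn, where ?'q='q]
  show ?thesis
  proof
    assume gkp: "is_GKP_code emb G k n l"
    then have rp: "rank_preserving emb G k n"
      using rank_preserving_if_MRD[OF _ kn G_rank] is_GKP_code_def by blast
    show "is_MRD_l emb G k n l"
      unfolding is_MRD_l_def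
    proof (intro allI impI antisym)
      fix V :: "nat \<Rightarrow> (nat \<Rightarrow> 'q) set"
      assume V: "\<forall>i<l. Fq_subspace n (V i) \<and> vs.dim (V i) \<le> k"
      \<comment> \<open>One lemma gives both inequalities: here \<open>Zmat\<close> is the
        rank-preserving matrix and \<open>G\<close> the attaining one, and below the roles are
        exchanged.\<close>
      show "vs.dim (\<Inter>i<l. Gspan emb G k n (V i)) \<le> vs.dim (\<Inter>i<l. ?W (V i))"
        using gkp V by (intro dim_Inter_Gspan_le[OF constK.emb_0 rpZ _ \<open>1 \<le> l\<close>]) (auto simp: is_GKP_code_def)
      show "vs.dim (\<Inter>i<l. ?W (V i)) \<le> vs.dim (\<Inter>i<l. Gspan emb G k n (V i))"
        using V by (intro dim_Inter_Gspan_le[OF emb_0 rp attains_Zmat[OF _ kn] \<open>1 \<le> l\<close>]) auto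
    qed
  next
    assume mrd: "is_MRD_l emb G k n l"
    have dims: "vs.dim (\<Inter>i<l. Gspan emb G k n (V i)) = vs.dim (\<Inter>i<l. ?W (V i))"
      if "\<And>i. i < l \<Longrightarrow> Fq_subspace n (V i)" "\<And>i. i < l \<Longrightarrow> vs.dim (V i) \<le> k" for V
      using mrd that unfolding is_MRD_l_def by blast
    have ne: "{..<l} \<noteq> {}" using \<open>1 \<le> l\<close> by (simp add: lessThan_empty_iff)
    have rp: "rank_preserving emb G k n"
      unfolding rank_preserving_def
    proof (intro allI impI)
      fix V :: "(nat \<Rightarrow> 'q) set" assume V: "Fq_subspace n V \<and> vs.dim V \<le> k"
      \<comment> \<open>A constant family reduces MRD(l) to single subspaces.\<close>
      have "vs.dim (Gspan emb G k n V) = vs.dim (?W V)"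
        using dims[of "\<lambda>_. V"] V ne by (simp add: INF_constant)
      then show "vs.dim (Gspan emb G k n V) = vs.dim V"
        using rpZ V unfolding rank_preserving_def by metis
    qed
    have "attains emb G k n V" if V: "is_GKP k n V" "kp_order k V \<le> l" for V
    proof (rule attains_if_dim_Inter_le)
      fix J assume J: "J \<noteq> {}" "J \<subseteq> {..<k}"
      show "vs.dim (\<Inter>i\<in>J. Gspan emb G k n (V i)) \<le> k - card J"
      \<comment> \<open>The order ignores the zero subspace, so only without it are there at most
        \<open>l\<close> distinct members to which MRD(l) applies. With it the intersection is
        zero.\<close>
      proof (cases "\<exists>i\<in>J. V i = {0}")
        case True
        then obtain i where i: "i \<in> J" "V i = {0}" by blast
        have "Gspan emb G k n (V i) = {0}" using i by (simp add: Gspan_eq colvec_0)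
        then have "(\<Inter>i\<in>J. Gspan emb G k n (V i)) \<subseteq> vs.span {}" using i(1) by auto
        then have "vs.dim (\<Inter>i\<in>J. Gspan emb G k n (V i)) \<le> card ({} :: (nat \<Rightarrow> 'f) set)"
          by (rule vs.dim_le_card) simp
        then show ?thesis by simp
      next
        case False
        have "card (V ` J) \<le> kp_order k V"
          unfolding kp_order_def using J False by (intro card_mono) (auto simp: vec_zero_eq)
        then obtain f where f: "f ` {..<l} = V ` J"
          using finite_set_enumeration[of "V ` J" l] J V(2) finite_subset[OF J(2)] by auto
        have mem: "\<exists>i<k. f j = V i" if "j < l" for j
        proof -
          have "f j \<in> V ` J" using f that by auto
          then show ?thesis using J(2) by auto
        qed
        have "Fq_subspace n (f j)" "vs.dim (f j) \<le> k" if "j < l" for j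
          using mem[OF that] V(1) is_GKP_dim_le[OF V(1)] by (auto simp: is_GKP_def)
        then have "vs.dim (\<Inter>j<l. Gspan emb G k n (f j)) = vs.dim (\<Inter>j<l. ?W (f j))" by (rule dims)
        moreover have "(\<Inter>j<l. Gspan emb G k n (f j)) = (\<Inter>i\<in>J. Gspan emb G k n (V i))"
          using arg_cong[OF f, of "\<lambda>A. \<Inter> (Gspan emb G k n ` A)"] by (simp add: image_image)
        moreover have "(\<Inter>j<l. ?W (f j)) = (\<Inter>i\<in>J. ?W (V i))"
          using arg_cong[OF f, of "\<lambda>A. \<Inter> (?W ` A)"] by (simp add: image_image)
        ultimately show ?thesis using dim_Inter_Gspan_Zmat_le[OF V(1) kn J] by simp
      qed
    qed
    then show "is_GKP_code emb G k n l"
      using MRD_if_rank_preserving[OF rp kn] by (simp add: is_GKP_code_def)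
  qed
qed

end
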